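(* Let $f:[0,\infty)\to\mathbb{R}$ be a nonnegative, monotone decreasing (non-increasing) function with $f(0)=1$. Let $X=\{x_k\}_{k\in\mathbb{N}}\subset\mathbb{R}^n$ be a separated sequence of distinct points with $x_1=0$, and let $d=\dim\mathcal{L}(X)$, where $\mathcal{L}(X)$ is the linear span of $X$. (i) If $\int_0^\infty t^{d-1}f(t)\,dt<\infty$, then the Schoenberg matrix $\mathcal{S}_X(f)=\|f(|x_i-x_j|)\|_{i,j\in\mathbb{N}}$ generates a bounded operator $S_X(f)$ on $\ell^2(\mathbb{N})$ and $$\|S_X(f)\|\le 1+d^2\Bigl(\frac{5}{d_*(X)}\Bigr)^d\int_0^\infty t^{d-1}f(t)\,dt .$$ (ii) Moreover, $S_X(f)$ has a bounded inverse whenever, in addition, $$d_*(X)>5\,d^{2/d}\Bigl(\int_0^\infty t^{d-1}f(t)\,dt\Bigr)^{1/d}.$$ (iii) Conversely, suppose that for at least one $\delta>0$ and at least one $\delta$-regular set $Y=\{y_j\}_{j\in\mathbb{N}}$ with $\dim\mathcal{L}(Y)=d$ the matrix $\mathcal{S}_Y(f)$ generates a bounded operator $S_Y(f)$ on $\ell^2(\mathbb{N})$. Then $\int_0^\infty t^{d-1}f(t)\,dt<\infty$.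
   Context: $|\cdot|$ is the Euclidean norm on $\mathbb{R}^n$, $n\in\mathbb{N}$ arbitrary. For a sequence $X=\{x_k\}_{k\in\mathbb{N}}$ of distinct points in $\mathbb{R}^n$, put $d_*(X)=\inf_{i\ne j}|x_i-x_j|$; $X$ is separated if $d_*(X)>0$. Sequences are normalized so that the first point is the origin, and $\mathcal{L}(X)$ denotes the linear span of $X$. An infinite matrix $\|a_{kj}\|$ generates a bounded operator $A$ on $\ell^2(\mathbb{N})$ if there is a bounded linear $A$ with $\langle Ax,y\rangle=\sum_{k,j}a_{kj}x_k\overline{y_j}$ for all $x,y\in\ell^2(\mathbb{N})$. A separated sequence $Y=\{y_j\}_{j\in\mathbb{N}}$ (with $y_1=0$) with $\dim\mathcal{L}(Y)=d$ is called $\delta$-regular ($\delta>0$) if there are constants $c_0>0$ and $r_0\ge 0$, independent of $j$, such that the number of points $y_k\in Y$ with $r\le|y_k-y_j|<r+\delta$ is at least $c_0\,r^{d-1}$ for all $r\ge r_0$ and all $j\in\mathbb{N}$. *)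

theory Defs
  imports "HOL-Analysis.Analysis"
begin

section \<open>The Hilbert space of square-summable complex sequences\<close>

typedef ell2 = "{x :: nat \<Rightarrow> complex. summable (\<lambda>k. (cmod (x k))\<^sup>2)}"
  morphisms ell2_nth Abs_ell2
  by (rule exI[of _ "\<lambda>_. 0"]) simp

setup_lifting type_definition_ell2

lemma summable_ell2: "summable (\<lambda>k. (cmod (ell2_nth x k))\<^sup>2)"
  using ell2_nth[of x] by simp

lemma cmod_mult_le_squares: "cmod (a * b) \<le> (cmod a)\<^sup>2 + (cmod b)\<^sup>2"
proof -
  have "0 \<le> (cmod a - cmod b)\<^sup>2" "0 \<le> (cmod a)\<^sup>2" "0 \<le> cmod a * cmod b"
    by simp_all
  then have "cmod a * cmod b \<le> (cmod a)\<^sup>2 + (cmod b)\<^sup>2"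
    unfolding power2_diff by linarith
  then show ?thesis
    by (simp add: norm_mult)
qed

lemma summable_square_add:
  assumes "summable (\<lambda>k. (cmod (x k))\<^sup>2)" "summable (\<lambda>k. (cmod (y k))\<^sup>2)"
  shows "summable (\<lambda>k. (cmod (x k + y k))\<^sup>2)"
proof (rule summable_comparison_test')
  show "summable (\<lambda>k. 2 * (cmod (x k))\<^sup>2 + 2 * (cmod (y k))\<^sup>2)"
    using assms by (intro summable_add summable_mult)
  fix k :: nat
  have "(cmod (x k + y k))\<^sup>2 \<le> (cmod (x k) + cmod (y k))\<^sup>2"
    by (intro power_mono norm_triangle_ineq) simp
  also have "\<dots> \<le> 2 * (cmod (x k))\<^sup>2 + 2 * (cmod (y k))\<^sup>2"
    using zero_le_power2[of "cmod (x k) - cmod (y k)"]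
    by (simp add: power2_diff power2_sum)
  finally show "norm ((cmod (x k + y k))\<^sup>2) \<le> 2 * (cmod (x k))\<^sup>2 + 2 * (cmod (y k))\<^sup>2"
    by simp
qed

lemma summable_ell2_prod: "summable (\<lambda>k. ell2_nth x k * cnj (ell2_nth y k))"
proof (rule summable_comparison_test')
  show "summable (\<lambda>k. (cmod (ell2_nth x k))\<^sup>2 + (cmod (ell2_nth y k))\<^sup>2)"
    by (intro summable_add summable_ell2)
  show "norm (ell2_nth x k * cnj (ell2_nth y k))
      \<le> (cmod (ell2_nth x k))\<^sup>2 + (cmod (ell2_nth y k))\<^sup>2" for k
    using cmod_mult_le_squares[of "ell2_nth x k" "cnj (ell2_nth y k)"] by simp
qed

lift_definition ell2_scaleC :: "complex \<Rightarrow> ell2 \<Rightarrow> ell2" is "\<lambda>c x k. c * x k"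
  by (simp add: norm_mult power_mult_distrib summable_mult)

definition ell2_inner :: "ell2 \<Rightarrow> ell2 \<Rightarrow> complex" where
  "ell2_inner x y = (\<Sum>k. ell2_nth x k * cnj (ell2_nth y k))"

instantiation ell2 :: real_vector
begin

lift_definition zero_ell2 :: ell2 is "\<lambda>_. 0" by simp

lift_definition plus_ell2 :: "ell2 \<Rightarrow> ell2 \<Rightarrow> ell2" is "\<lambda>x y k. x k + y k"
  by (rule summable_square_add)

lift_definition uminus_ell2 :: "ell2 \<Rightarrow> ell2" is "\<lambda>x k. - x k" by simp

lift_definition minus_ell2 :: "ell2 \<Rightarrow> ell2 \<Rightarrow> ell2" is "\<lambda>x y k. x k - y k"
proof -
  fix x y :: "nat \<Rightarrow> complex"
  assume "summable (\<lambda>k. (cmod (x k))\<^sup>2)" "summable (\<lambda>k. (cmod (y k))\<^sup>2)"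
  then show "summable (\<lambda>k. (cmod (x k - y k))\<^sup>2)"
    using summable_square_add[of x "\<lambda>k. - y k"] by simp
qed

lift_definition scaleR_ell2 :: "real \<Rightarrow> ell2 \<Rightarrow> ell2" is "\<lambda>c x k. c *\<^sub>R x k"
  by (simp add: power_mult_distrib summable_mult)

instance
proof
  fix x y z :: ell2 and r s :: real
  show "x + y + z = x + (y + z)" by transfer (simp add: add.assoc)
  show "x + y = y + x" by transfer (simp add: add.commute)
  show "0 + x = x" by transfer simp
  show "- x + x = 0" by transfer simp
  show "x - y = x + - y" by transfer simp
  show "r *\<^sub>R (x + y) = r *\<^sub>R x + r *\<^sub>R y" by transfer (simp add: scaleR_add_right)
  show "(r + s) *\<^sub>R x = r *\<^sub>R x + s *\<^sub>R x" by transfer (simp add: scaleR_add_left)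
  show "r *\<^sub>R s *\<^sub>R x = (r * s) *\<^sub>R x" by transfer simp
  show "1 *\<^sub>R x = x" by transfer simp
qed

end

text \<open>
  The library has no complex inner product class, so the norm and topology come from the
  underlying real Hilbert space with inner product \<open>Re (ell2_inner x y)\<close>; the norm is
  the usual one.
\<close>

instantiation ell2 :: real_inner
begin

definition inner_ell2 :: "ell2 \<Rightarrow> ell2 \<Rightarrow> real" where
  "inner_ell2 x y = Re (ell2_inner x y)"

definition norm_ell2 :: "ell2 \<Rightarrow> real" where
  "norm_ell2 x = sqrt (inner x x)"

definition dist_ell2 :: "ell2 \<Rightarrow> ell2 \<Rightarrow> real" where
  "dist_ell2 x y = norm (x - y)"

definition sgn_ell2 :: "ell2 \<Rightarrow> ell2" where
  "sgn_ell2 x = x /\<^sub>R norm x"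

definition uniformity_ell2 :: "(ell2 \<times> ell2) filter" where
  "uniformity_ell2 = (INF e\<in>{0<..}. principal {(x, y). dist x y < e})"

definition open_ell2 :: "ell2 set \<Rightarrow> bool" where
  "open_ell2 U \<longleftrightarrow> (\<forall>x\<in>U. \<forall>\<^sub>F (x', y) in uniformity. x' = x \<longrightarrow> y \<in> U)"

instance
proof
  fix x y z :: ell2 and r :: real and U :: "ell2 set"
  show "dist x y = norm (x - y)" by (rule dist_ell2_def)
  show "sgn x = x /\<^sub>R norm x" by (rule sgn_ell2_def)
  show "uniformity = (INF e\<in>{0<..}. principal {(x::ell2, y). dist x y < e})"
    by (rule uniformity_ell2_def)
  show "open U \<longleftrightarrow> (\<forall>x\<in>U. \<forall>\<^sub>F (x', y) in uniformity. x' = x \<longrightarrow> y \<in> U)"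
    by (rule open_ell2_def)
  show "norm x = sqrt (inner x x)" by (rule norm_ell2_def)
  have S: "summable (\<lambda>k. Re (ell2_nth u k * cnj (ell2_nth v k)))" for u v
    by (rule summable_Re[OF summable_ell2_prod])
  have I: "inner u v = (\<Sum>k. Re (ell2_nth u k * cnj (ell2_nth v k)))" for u v :: ell2
    unfolding inner_ell2_def ell2_inner_def by (rule Re_suminf[OF summable_ell2_prod])
  have N: "inner x x = (\<Sum>k. (cmod (ell2_nth x k))\<^sup>2)"
    unfolding I by (simp only: complex_norm_square[symmetric] Re_complex_of_real)
  show "inner x y = inner y x"
    unfolding I by (rule arg_cong[where f = suminf]) (auto simp: fun_eq_iff algebra_simps)
  show "inner (x + y) z = inner x z + inner y z"
    unfolding I suminf_add[OF S S] plus_ell2.rep_eq by (simp add: algebra_simps)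
  show "inner (r *\<^sub>R x) y = r * inner x y"
    unfolding I suminf_mult[OF S, symmetric] scaleR_ell2.rep_eq by (simp add: algebra_simps)
  show "0 \<le> inner x x"
    unfolding N by (rule suminf_nonneg[OF summable_ell2]) simp
  have "inner x x = 0 \<longleftrightarrow> (\<forall>k. ell2_nth x k = 0)"
    unfolding N by (subst suminf_eq_zero_iff[OF summable_ell2]) auto
  also have "\<dots> \<longleftrightarrow> x = 0" by transfer auto
  finally show "inner x x = 0 \<longleftrightarrow> x = 0" .
qed

end

lemma norm_ell2_eq: "norm x = sqrt (\<Sum>k. (cmod (ell2_nth x k))\<^sup>2)"
  unfolding norm_ell2_def inner_ell2_def ell2_inner_def Re_suminf[OF summable_ell2_prod]
  by (simp only: complex_norm_square[symmetric] Re_complex_of_real)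

section \<open>Operators generated by infinite matrices\<close>

definition bounded_clinear_ell2 :: "(ell2 \<Rightarrow> ell2) \<Rightarrow> bool" where
  "bounded_clinear_ell2 A \<longleftrightarrow>
     bounded_linear A \<and> (\<forall>c x. A (ell2_scaleC c x) = ell2_scaleC c (A x))"

text \<open>
  The double series is taken as the limit of its rectangular partial sums. Unconditional
  convergence would be too restrictive for general matrices: it fails for some bounded
  operators whose matrix has entries of varying sign.
\<close>

definition generates_bounded_operator ::
    "(nat \<Rightarrow> nat \<Rightarrow> complex) \<Rightarrow> (ell2 \<Rightarrow> ell2) \<Rightarrow> bool" where
  "generates_bounded_operator a A \<longleftrightarrow>
     bounded_clinear_ell2 A \<and>
     (\<forall>x y. ((\<lambda>(N, M). \<Sum>k<N. \<Sum>j<M. a k j * ell2_nth x k * cnj (ell2_nth y j))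
              \<longlongrightarrow> ell2_inner (A x) y) (at_top \<times>\<^sub>F at_top))"

definition has_bounded_inverse :: "(ell2 \<Rightarrow> ell2) \<Rightarrow> bool" where
  "has_bounded_inverse A \<longleftrightarrow>
     (\<exists>B. bounded_clinear_ell2 B \<and> (\<forall>x. A (B x) = x) \<and> (\<forall>x. B (A x) = x))"

section \<open>Separated and regular sequences, Schoenberg matrices\<close>

text \<open>Sequences are indexed from \<open>0\<close>, so the normalization of the first point reads \<open>X 0 = 0\<close>.\<close>

definition separation :: "(nat \<Rightarrow> real ^ 'n) \<Rightarrow> real" where
  "separation X = (INF (i, j)\<in>{(i, j). i \<noteq> j}. norm (X i - X j))"

definition separated :: "(nat \<Rightarrow> real ^ 'n) \<Rightarrow> bool" where
  "separated X \<longleftrightarrow> separation X > 0"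

definition schoenberg_matrix ::
    "(nat \<Rightarrow> real ^ 'n) \<Rightarrow> (real \<Rightarrow> real) \<Rightarrow> nat \<Rightarrow> nat \<Rightarrow> complex" where
  "schoenberg_matrix X f i j = complex_of_real (f (norm (X i - X j)))"

text \<open>
  Points are counted by their indices, which is the same because the points are distinct;
  the index sets are finite because \<open>Y\<close> is separated.
\<close>

definition delta_regular :: "real \<Rightarrow> (nat \<Rightarrow> real ^ 'n) \<Rightarrow> bool" where
  "delta_regular \<delta> Y \<longleftrightarrow>
     \<delta> > 0 \<and> inj Y \<and> separated Y \<and> Y 0 = 0 \<and>
     (\<exists>c\<^sub>0 > 0. \<exists>r\<^sub>0 \<ge> 0. \<forall>r \<ge> r\<^sub>0. \<forall>j.
        real (card {k. r \<le> norm (Y k - Y j) \<and> norm (Y k - Y j) < r + \<delta>})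
          \<ge> c\<^sub>0 * r ^ (dim (span (range Y)) - 1))"

end

theory Submission
  imports Defs
begin

text \<open>
  Upper bound: disjoint balls of radius \<open>s / 2\<close> in the \<open>d\<close>-dimensional span, where \<open>s\<close> is the
  separation, show that the shell \<open>k s \<le> |x_j - x_i| < (k + 1) s\<close> contains at most
  \<open>(2 k + 3)^d - (2 k - 1)^d \<le> 4 d (5 k)^(d - 1)\<close> points. Since \<open>f\<close> decreases,
  \<open>s^d k^(d - 1) f (k s)\<close> is at most \<open>d\<close> times the integral of \<open>t^(d - 1) f t\<close> over
  \<open>[(k - 1) s, k s]\<close>, so the off-diagonal row sums of the matrix are bounded by
  \<open>d^2 (5 / s)^d\<close> times the full integral. Schur's test gives the norm bound, and the operator
  is invertible as a perturbation of the identity when this bound is less than \<open>1\<close>.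
  Converse: test the operator on indicators of large balls.
\<close>

text \<open>The ambient dimension must not enter the exponents, so the span is carried isometrically
  onto a coordinate subspace of dimension \<open>d\<close> before volumes are compared. Off-diagonal
  distances are at least the separation, so the shells start at \<open>k = 1\<close>; hence each
  shell can be charged to the interval just before it, and the charges still begin at
  \<open>0\<close>. The \<open>5\<close> comes from \<open>2 k + 3 <= 5 k\<close>. One factor
  \<open>d\<close> comes from the difference of two \<open>d\<close>-th powers, the other from
  integrating \<open>t^(d - 1)\<close>; \<open>4 * 5^(d - 1)\<close> is rounded up to
  \<open>5^d\<close>. Since \<open>f 0 = 1\<close>, the diagonal is the identity, which explains
  both the summand \<open>1\<close> in the norm bound and the invertibility criterion. In the
  converse a single row does not suffice, because boundedness only makes rows square-summable. The
  quadratic form on an indicator controls an average of row sums, and regularity, being uniform in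
  the base point, bounds every row in that average below by the same truncated moment.\<close>

section \<open>Packing in the span\<close>

text \<open>The unit intervals in the coordinates outside \<open>I\<close> give balls of the \<open>card I\<close>-dimensional
  coordinate subspace positive Lebesgue measure in the ambient space.\<close>

definition cylinder :: "'n::finite set \<Rightarrow> real ^ 'n \<Rightarrow> real \<Rightarrow> (real ^ 'n) set" where
  "cylinder I c r =
     {x. L2_set (\<lambda>i. x $ i - c $ i) I < r \<and> (\<forall>i. i \<notin> I \<longrightarrow> 0 \<le> x $ i \<and> x $ i \<le> 1)}"

lemma lmeasurable_cylinder:
  fixes I :: "'n::finite set"
  shows "cylinder I c r \<in> lmeasurable"
proof -
  have "bounded (cylinder I c r)"
  proof (rule boundedI)
    fix x assume x: "x \<in> cylinder I c r"
    have "\<bar>x $ i\<bar> \<le> 1 + \<bar>r\<bar> + \<bar>c $ i\<bar>" for i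
    proof (cases "i \<in> I")
      case True
      have "\<bar>x $ i - c $ i\<bar> \<le> L2_set (\<lambda>i. \<bar>x $ i - c $ i\<bar>) I"
        using True by (intro member_le_L2_set) auto
      also have "\<dots> = L2_set (\<lambda>i. x $ i - c $ i) I"
        by (simp add: L2_set_def)
      finally show ?thesis
        using x by (auto simp: cylinder_def)
    next
      case False
      then show ?thesis using x by (auto simp: cylinder_def)
    qed
    then show "norm x \<le> (\<Sum>i\<in>UNIV. 1 + \<bar>r\<bar> + \<bar>c $ i\<bar>)"
      by (intro order_trans[OF norm_le_l1_cart] sum_mono)
  qed
  moreover have "cylinder I c r \<in> sets borel"
  proof -
    have "{x. L2_set (\<lambda>i. x $ i - c $ i) I < r} \<in> sets borel"
      unfolding L2_set_def
      by (intro borel_open open_Collect_less continuous_intros)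
    moreover have "{x. \<forall>i. i \<notin> I \<longrightarrow> 0 \<le> x $ i \<and> x $ i \<le> 1} \<in> sets (borel :: (real ^ 'n) measure)"
      by (intro borel_closed closed_Collect_all closed_Collect_imp closed_Collect_conj
          closed_Collect_le open_Collect_const continuous_intros)
    ultimately show ?thesis
      unfolding cylinder_def Collect_conj_eq by blast
  qed
  ultimately show ?thesis
    by (intro bounded_set_imp_lmeasurable) auto
qed

text \<open>The dilation acts only on the coordinates in \<open>I\<close>, so its determinant is
  \<open>r ^ card I\<close>: scaling with the dimension of the subspace comes out of a
  full-dimensional measure.\<close>

lemma cylinder_eq_image:
  fixes I :: "'n::finite set"
  assumes r: "0 < r"
  shows "cylinder I c r =
    (+) (\<chi> i. if i \<in> I then c $ i else 0) `
      (\<lambda>x. \<chi> i. (if i \<in> I then r else 1) * x $ i) ` cylinder I 0 1" (is "_ = ?T ` ?M ` _")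
proof (intro set_eqI iffI)
  fix x assume x: "x \<in> cylinder I c r"
  define y :: "real ^ 'n" where "y = (\<chi> i. if i \<in> I then (x $ i - c $ i) / r else x $ i)"
  have "L2_set (\<lambda>i. y $ i - 0 $ i) I = L2_set (\<lambda>i. inverse r * (x $ i - c $ i)) I"
    by (rule L2_set_cong) (auto simp: y_def field_simps)
  also have "\<dots> = L2_set (\<lambda>i. x $ i - c $ i) I / r"
    using r by (subst L2_set_right_distrib[symmetric]) (auto simp: field_simps)
  finally have "y \<in> cylinder I 0 1"
    using x r by (simp add: cylinder_def) (simp add: y_def)
  moreover have "x = ?T (?M y)"
    using r by (auto simp: vec_eq_iff y_def)
  ultimately show "x \<in> ?T ` ?M ` cylinder I 0 1" by blast
next
  fix x assume "x \<in> ?T ` ?M ` cylinder I 0 1"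
  then obtain y where y: "y \<in> cylinder I 0 1" and x: "x = ?T (?M y)" by auto
  have "L2_set (\<lambda>i. x $ i - c $ i) I = L2_set (\<lambda>i. r * (y $ i - 0 $ i)) I"
    by (rule L2_set_cong) (auto simp: x)
  also have "\<dots> = r * L2_set (\<lambda>i. y $ i - 0 $ i) I"
    using r by (subst L2_set_right_distrib[symmetric]) auto
  finally show "x \<in> cylinder I c r"
    using y r by (auto simp: cylinder_def x)
qed

lemma measure_cylinder:
  assumes "0 < r"
  shows "measure lebesgue (cylinder I c r) = r ^ card I * measure lebesgue (cylinder I 0 1)"
proof -
  have "(\<Prod>i\<in>UNIV. if i \<in> I then r else 1) = r ^ card I"
    by (simp add: prod.If_cases)
  then show ?thesis
    unfolding cylinder_eq_image[OF assms] measure_translation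
      measure_stretch[OF lmeasurable_cylinder] using assms by simp
qed

lemma measure_unit_cylinder_pos:
  fixes I :: "'n::finite set"
  shows "0 < measure lebesgue (cylinder I 0 1)"
proof -
  \<comment> \<open>With this side length the l1 norm of a point of the cube is below
    \<open>1\<close>, so the cube fits. Only positivity matters later: the measure of the unit
    cylinder cancels in the packing inequality.\<close>
  define e where "e = 1 / (real CARD('n) + 1)"
  have e: "0 < e" "e \<le> 1" by (auto simp: e_def)
  define b :: "real ^ 'n" where "b = (\<chi> i. e)"
  have "cbox 0 b \<subseteq> cylinder I 0 1"
  proof
    fix x assume x: "x \<in> cbox 0 b"
    have "L2_set (\<lambda>i. x $ i - 0 $ i) I \<le> (\<Sum>i\<in>I. \<bar>x $ i\<bar>)"
      using L2_set_le_sum_abs[of "\<lambda>i. x $ i" I] by simp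
    also have "\<dots> \<le> (\<Sum>i\<in>I. e)"
      using x by (intro sum_mono) (auto simp: mem_box_cart b_def)
    also have "\<dots> \<le> real CARD('n) * e"
      using e card_mono[of UNIV I] by (auto simp: mult_right_mono)
    also have "\<dots> < 1"
      by (simp add: e_def field_simps)
    finally show "x \<in> cylinder I 0 1"
      using x e by (auto simp: cylinder_def mem_box_cart b_def intro: order_trans)
  qed
  then have "measure lebesgue (cbox 0 b) \<le> measure lebesgue (cylinder I 0 1)"
    by (intro measure_mono_fmeasurable) (auto simp: lmeasurable_cylinder)
  moreover have "0 < measure lebesgue (cbox 0 b)"
  proof -
    have "box 0 b \<noteq> {}"
      using e by (simp add: interval_ne_empty_cart b_def)
    then have "\<not> negligible (cbox 0 b)"
      by (simp add: negligible_interval)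
    then show ?thesis
      by (simp add: negligible_iff_measure order_less_le)
  qed
  ultimately show ?thesis by linarith
qed

section \<open>Coordinate subspaces as models of the span, and packing in them\<close>

definition coordinate_subspace :: "'n set \<Rightarrow> (real ^ 'n) set" where
  "coordinate_subspace I = {x. \<forall>i. i \<notin> I \<longrightarrow> x $ i = 0}"

lemma subspace_coordinate_subspace: "subspace (coordinate_subspace I)"
  by (auto simp: subspace_def coordinate_subspace_def)

lemma dim_coordinate_subspace:
  fixes I :: "'n::finite set"
  shows "dim (coordinate_subspace I) = card I"
proof -
  have "coordinate_subspace I =
      {x :: real ^ 'n. \<forall>b\<in>Basis. b \<notin> (\<lambda>i. axis i 1) ` I \<longrightarrow> x \<bullet> b = 0}"
    by (auto simp: coordinate_subspace_def Basis_vec_def inner_axis axis_eq_axis image_iff)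
  moreover have "dim {x :: real ^ 'n. \<forall>b\<in>Basis. b \<notin> (\<lambda>i. axis i 1) ` I \<longrightarrow> x \<bullet> b = 0} = card I"
    by (subst dim_substandard) (auto simp: card_image inj_on_def axis_eq_axis Basis_vec_def)
  ultimately show ?thesis by simp
qed

lemma dist_coordinate_subspace:
  assumes "x \<in> coordinate_subspace I" "y \<in> coordinate_subspace I"
  shows "dist x y = L2_set (\<lambda>i. x $ i - y $ i) I"
proof -
  have "(\<Sum>i\<in>UNIV. (x $ i - y $ i)\<^sup>2) = (\<Sum>i\<in>I. (x $ i - y $ i)\<^sup>2)"
    using assms by (intro sum.mono_neutral_right) (auto simp: coordinate_subspace_def)
  then show ?thesis
    by (simp add: dist_norm norm_vec_def L2_set_def)
qed

lemma L2_set_diff_triangle: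
  "L2_set (\<lambda>i. f i - h i) I \<le> L2_set (\<lambda>i. f i - g i) I + L2_set (\<lambda>i. g i - h i) I"
  using L2_set_triangle_ineq[of "\<lambda>i. f i - g i" "\<lambda>i. g i - h i" I] by simp

lemma L2_set_diff_commute: "L2_set (\<lambda>i. f i - g i) I = L2_set (\<lambda>i. g i - f i) I"
  by (simp add: L2_set_def power2_commute)

text \<open>Cylinders of radius \<open>s / 2\<close> about the points are disjoint, lie in the one
  of radius \<open>b + s / 2\<close> about \<open>c\<close>, and miss the one of radius
  \<open>a\<close>; the common factor in their measures cancels. The alternative
  \<open>a = 0\<close> admits \<open>c\<close> itself as a point of \<open>P\<close>, so that full
  balls are covered too.\<close>

lemma packing_coordinate_subspace:
  assumes P: "finite P" "P \<subseteq> coordinate_subspace I" and c: "c \<in> coordinate_subspace I"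
    and I: "I \<noteq> {}"
    and s: "0 < s" "\<And>p q. p \<in> P \<Longrightarrow> q \<in> P \<Longrightarrow> p \<noteq> q \<Longrightarrow> s \<le> dist p q"
    and ab: "0 \<le> a" "a \<le> b"
    and out: "\<And>p. p \<in> P \<Longrightarrow> dist p c \<le> b"
    and inn: "\<And>p. p \<in> P \<Longrightarrow> a = 0 \<or> a + s / 2 \<le> dist p c"
  shows "real (card P) * (s / 2) ^ card I \<le> (b + s / 2) ^ card I - a ^ card I"
proof -
  let ?m = "measure lebesgue" and ?K = "measure lebesgue (cylinder I 0 1)"
  have [simp]: "finite I" by simp
  note dc = dist_coordinate_subspace
  define U where "U = (\<Union>p\<in>P. cylinder I p (s / 2))"
  have Pc: "p \<in> coordinate_subspace I" if "p \<in> P" for p using P that by auto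
  have disj: "disjoint_family_on (\<lambda>p. cylinder I p (s / 2)) P"
  proof (unfold disjoint_family_on_def, intro ballI impI equals0I)
    fix p q x assume pq: "p \<in> P" "q \<in> P" "p \<noteq> q"
      and x: "x \<in> cylinder I p (s / 2) \<inter> cylinder I q (s / 2)"
    have "s \<le> L2_set (\<lambda>i. p $ i - q $ i) I"
      using s(2)[OF pq] dc[OF Pc Pc, OF pq(1,2)] by simp
    then show False
      using x L2_set_diff_triangle[of "\<lambda>i. p $ i" "\<lambda>i. q $ i" I "\<lambda>i. x $ i"]
        L2_set_diff_commute[of "\<lambda>i. p $ i" "\<lambda>i. x $ i" I]
      by (auto simp: cylinder_def)
  qed
  have U: "U \<in> lmeasurable"
    unfolding U_def by (intro fmeasurable.finite_UN P lmeasurable_cylinder)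
  have mU: "?m U = real (card P) * (s / 2) ^ card I * ?K"
  proof -
    have "?m U = (\<Sum>p\<in>P. ?m (cylinder I p (s / 2)))"
      unfolding U_def
      using disj
      by (intro measure_UNION' P lmeasurable_cylinder)
        (auto simp: disjoint_family_on_def pairwise_def disjnt_def)
    also have "\<dots> = (\<Sum>p\<in>P. (s / 2) ^ card I * ?K)"
      using s by (intro sum.cong refl measure_cylinder) auto
    finally show ?thesis by simp
  qed
  define D where "D = cylinder I c (b + s / 2)"
  define E where "E = cylinder I c a"
  have D: "D \<in> lmeasurable" and E: "E \<in> lmeasurable"
    by (simp_all add: D_def E_def lmeasurable_cylinder)
  have mD: "?m D = (b + s / 2) ^ card I * ?K"
    unfolding D_def using ab s by (intro measure_cylinder) auto
  have E0: "E = {}" if "a = 0"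
  proof (rule equals0I)
    fix x assume "x \<in> E"
    then have "L2_set (\<lambda>i. x $ i - c $ i) I < 0" by (simp add: E_def cylinder_def that)
    then show False using L2_set_nonneg[of "\<lambda>i. x $ i - c $ i" I] by linarith
  qed
  \<comment> \<open>For \<open>a = 0\<close> the empty hole has to match \<open>a ^ card I\<close>,
    which is \<open>0\<close> because \<open>I\<close> is nonempty.\<close>
  have mE: "?m E = a ^ card I * ?K"
  proof (cases "a = 0")
    case True
    moreover have "0 < card I" using I by (simp add: card_gt_0_iff)
    ultimately show ?thesis using E0 by (simp add: zero_power)
  next
    case False
    then show ?thesis unfolding E_def using ab by (intro measure_cylinder) auto
  qed
  have "U \<subseteq> D"
  proof
    fix x assume "x \<in> U"
    then obtain p where p: "p \<in> P" "x \<in> cylinder I p (s / 2)" by (auto simp: U_def)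
    have "L2_set (\<lambda>i. p $ i - c $ i) I \<le> b"
      using out[OF p(1)] dc[OF Pc[OF p(1)] c] by simp
    then show "x \<in> D"
      using p L2_set_diff_triangle[of "\<lambda>i. x $ i" "\<lambda>i. c $ i" I "\<lambda>i. p $ i"]
      by (auto simp: D_def cylinder_def)
  qed
  moreover have "E \<subseteq> D"
    using ab s by (auto simp: D_def E_def cylinder_def)
  moreover have "U \<inter> E = {}"
  proof (rule equals0I)
    fix x assume x: "x \<in> U \<inter> E"
    then obtain p where p: "p \<in> P" "x \<in> cylinder I p (s / 2)" by (auto simp: U_def)
    have "a + s / 2 \<le> L2_set (\<lambda>i. p $ i - c $ i) I"
      using inn[OF p(1)] dc[OF Pc[OF p(1)] c] E0 x by auto
    then show False
      using x p L2_set_diff_triangle[of "\<lambda>i. p $ i" "\<lambda>i. c $ i" I "\<lambda>i. x $ i"]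
        L2_set_diff_commute[of "\<lambda>i. p $ i" "\<lambda>i. x $ i" I]
      by (auto simp: E_def cylinder_def)
  qed
  ultimately have *: "E - U = E" "U \<union> E \<subseteq> D" by auto
  have "?m U + ?m E \<le> ?m D"
    using measure_Un2[OF U E] * U E D
    by (metis fmeasurable.Un fmeasurableD measure_mono_fmeasurable)
  then have "(real (card P) * (s / 2) ^ card I) * ?K
      \<le> ((b + s / 2) ^ card I - a ^ card I) * ?K"
    by (simp add: mU mE mD algebra_simps)
  then show ?thesis
    using measure_unit_cylinder_pos[of I] by simp
qed

section \<open>Point counts for separated sequences\<close>

lemma separation_le_norm:
  assumes "i \<noteq> j"
  shows "separation X \<le> norm (X i - X j)"
  unfolding separation_def using assms
  by (intro cINF_lower2[where x = "(i, j)"] bdd_belowI2[where m = 0]) auto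

text \<open>A linear isometry takes the span onto a coordinate subspace of the same dimension; it
  preserves the distances between the points and, since \<open>s > 0\<close>, keeps them
  distinct.\<close>

lemma card_shell_le:
  fixes X :: "nat \<Rightarrow> real ^ 'n"
  assumes d: "d = dim (span (range X))" "0 < d"
    and s: "0 < s" "\<And>i j. i \<noteq> j \<Longrightarrow> s \<le> norm (X i - X j)"
    and J: "finite J" and ab: "0 \<le> a" "a \<le> b"
    and out: "\<And>j. j \<in> J \<Longrightarrow> norm (X j - X i) \<le> b"
    and inn: "\<And>j. j \<in> J \<Longrightarrow> a = 0 \<or> a + s / 2 \<le> norm (X j - X i)"
  shows "real (card J) * (s / 2) ^ d \<le> (b + s / 2) ^ d - a ^ d"
proof -
  have "d \<le> CARD('n)"
    using dim_subset_UNIV_cart[of "span (range X)"] d by simp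
  then obtain I :: "'n set" where I: "card I = d"
    using obtain_subset_with_card_n[of d "UNIV :: 'n set"] by auto
  obtain h :: "real ^ 'n \<Rightarrow> real ^ 'n"
    where h: "linear h" "h ` span (range X) = coordinate_subspace I"
      "\<And>x. x \<in> span (range X) \<Longrightarrow> norm (h x) = norm x"
    using isometries_subspaces[OF subspace_span[of "range X"] subspace_coordinate_subspace[of I]]
      dim_coordinate_subspace[of I] I d by metis
  have dist: "dist (h (X i)) (h (X j)) = norm (X i - X j)" for i j
    unfolding dist_norm linear_diff[OF h(1), symmetric]
    by (intro h(3) span_diff span_base) auto
  have inj: "inj_on (\<lambda>j. h (X j)) J"
  proof (rule inj_onI, rule ccontr)
    fix i j assume "h (X i) = h (X j)" "i \<noteq> j"
    then show False using s(1) s(2)[of i j] dist[of i j] by simp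
  qed
  have mem: "h (X j) \<in> coordinate_subspace I" for j
    unfolding h(2)[symmetric] by (intro imageI span_base) auto
  have "real (card ((\<lambda>j. h (X j)) ` J)) * (s / 2) ^ card I \<le> (b + s / 2) ^ card I - a ^ card I"
  proof (rule packing_coordinate_subspace[where c = "h (X i)"])
    show "I \<noteq> {}" using I d(2) by (intro notI) simp
    show "s \<le> dist p q" if "p \<in> (\<lambda>j. h (X j)) ` J" "q \<in> (\<lambda>j. h (X j)) ` J" "p \<noteq> q" for p q
    proof -
      obtain i j where "p = h (X i)" "q = h (X j)" using \<open>p \<in> _\<close> \<open>q \<in> _\<close> by blast
      then show ?thesis using \<open>p \<noteq> q\<close> s(2)[of i j] by (auto simp: dist)
    qed
    show "a = 0 \<or> a + s / 2 \<le> dist p (h (X i))" if p: "p \<in> (\<lambda>j. h (X j)) ` J" for p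
    proof -
      obtain j where "j \<in> J" "p = h (X j)" using p by blast
      then show ?thesis using inn[of j] by (simp add: dist)
    qed
  qed (use J ab s(1) out mem in \<open>auto simp: dist\<close>)
  then show ?thesis
    by (simp add: card_image[OF inj] I)
qed

text \<open>The case \<open>a = 0\<close> of the shell bound. It applies to all finite subsets of
  the index set, and this uniform bound forces the set to be finite before its own cardinality is
  estimated.\<close>

lemma card_ball_le:
  fixes X :: "nat \<Rightarrow> real ^ 'n"
  assumes d: "d = dim (span (range X))" "0 < d"
    and s: "0 < s" "\<And>i j. i \<noteq> j \<Longrightarrow> s \<le> norm (X i - X j)" and b: "0 \<le> b"
  shows "finite {j. norm (X j - X i) < b}"
    and "real (card {j. norm (X j - X i) < b}) \<le> (2 * b / s + 1) ^ d"
proof -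
  have *: "real (card J) \<le> (2 * b / s + 1) ^ d"
    if J: "J \<subseteq> {j. norm (X j - X i) < b}" "finite J" for J
  proof -
    have "real (card J) * (s / 2) ^ d \<le> (b + s / 2) ^ d - 0 ^ d"
      using J by (intro card_shell_le[where X = X and i = i] assms) auto
    also have "b + s / 2 = (2 * b / s + 1) * (s / 2)"
      using s by (simp add: field_simps)
    finally have "real (card J) * (s / 2) ^ d \<le> (2 * b / s + 1) ^ d * (s / 2) ^ d"
      using d(2) by (simp only: power_mult_distrib zero_power diff_0_right)
    then show ?thesis
      by (rule mult_right_le_imp_le) (use s in auto)
  qed
  then have "card J \<le> nat \<lfloor>(2 * b / s + 1) ^ d\<rfloor>"
    if "J \<subseteq> {j. norm (X j - X i) < b}" "finite J" for J
    using that by (simp add: le_nat_floor)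
  then show fin: "finite {j. norm (X j - X i) < b}"
    using finite_if_finite_subsets_card_bdd by blast
  show "real (card {j. norm (X j - X i) < b}) \<le> (2 * b / s + 1) ^ d"
    by (rule *[OF order_refl fin])
qed

section \<open>Operators on the sequence space\<close>

lemma norm_ell2_sq: "(norm x)\<^sup>2 = (\<Sum>k. (cmod (ell2_nth x k))\<^sup>2)"
  unfolding norm_ell2_eq by (intro real_sqrt_pow2 suminf_nonneg summable_ell2) auto

lemma sum_cmod_sq_le_norm_sq: "finite K \<Longrightarrow> (\<Sum>k\<in>K. (cmod (ell2_nth x k))\<^sup>2) \<le> (norm x)\<^sup>2"
  unfolding norm_ell2_sq by (intro sum_le_suminf summable_ell2) auto

lemma cmod_ell2_nth_le: "cmod (ell2_nth x k) \<le> norm x"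
  using sum_cmod_sq_le_norm_sq[of "{k}" x] by (simp add: power2_le_iff_abs_le)

text \<open>Reduces membership in the space and a norm bound to finite sums, which pass to limits
  termwise.\<close>

lemma ell2_of_bounded_sums:
  assumes "\<And>M. (\<Sum>k<M. (cmod (v k))\<^sup>2) \<le> B\<^sup>2" and "0 \<le> B"
  obtains x where "ell2_nth x = v" "norm x \<le> B"
proof
  have sm: "summable (\<lambda>k. (cmod (v k))\<^sup>2)"
    by (rule summableI_nonneg_bounded[where x = "B\<^sup>2"]) (use assms in auto)
  then show eq: "ell2_nth (Abs_ell2 v) = v"
    by (simp add: Abs_ell2_inverse)
  have "(norm (Abs_ell2 v))\<^sup>2 \<le> B\<^sup>2"
    unfolding norm_ell2_sq eq using sm by (intro suminf_le_const assms)
  then show "norm (Abs_ell2 v) \<le> B"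
    using assms(2) by (rule power2_le_imp_le)
qed

lemma ell2_eqI: "(\<And>k. ell2_nth x k = ell2_nth y k) \<Longrightarrow> x = y"
  by (metis ell2_nth_inject ext)

lemma norm_ell2_scaleC: "norm (ell2_scaleC c x) = cmod c * norm x"
proof -
  have "(norm (ell2_scaleC c x))\<^sup>2 = (cmod c * norm x)\<^sup>2"
    unfolding norm_ell2_sq power_mult_distrib ell2_scaleC.rep_eq norm_mult
    by (rule suminf_mult[OF summable_ell2])
  then show ?thesis by (simp add: power2_eq_iff_nonneg)
qed

lemma bounded_linear_ell2_scaleC: "bounded_linear (ell2_scaleC c)"
proof (rule bounded_linear_intro[where K = "cmod c"])
  show "ell2_scaleC c (x + y) = ell2_scaleC c x + ell2_scaleC c y" for x y
    by (rule ell2_eqI) (simp add: ell2_scaleC.rep_eq plus_ell2.rep_eq algebra_simps)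
  show "ell2_scaleC c (r *\<^sub>R x) = r *\<^sub>R ell2_scaleC c x" for r x
    by (rule ell2_eqI) (simp add: ell2_scaleC.rep_eq scaleR_ell2.rep_eq)
qed (simp add: norm_ell2_scaleC mult.commute)

text \<open>Conjugate linearity in the second argument: replacing \<open>y\<close> by
  \<open>\<i>\<close> times \<open>y\<close> multiplies the product by \<open>- \<i>\<close>, which
  moves the imaginary part to the real part. Continuity of the complex product thus follows from
  that of the real one.\<close>

lemma ell2_inner_eq_Complex: "ell2_inner x y = Complex (inner x y) (inner x (ell2_scaleC \<i> y))"
proof (rule complex_eqI)
  have "ell2_inner x (ell2_scaleC \<i> y) = (\<Sum>k. (- \<i>) * (ell2_nth x k * cnj (ell2_nth y k)))"
    unfolding ell2_inner_def ell2_scaleC.rep_eq by (simp add: algebra_simps)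
  also have "\<dots> = (- \<i>) * ell2_inner x y"
    unfolding ell2_inner_def by (rule suminf_mult[OF summable_ell2_prod])
  finally show "Im (ell2_inner x y) = Im (Complex (inner x y) (inner x (ell2_scaleC \<i> y)))"
    by (simp add: inner_ell2_def)
qed (simp add: inner_ell2_def)

lemma tendsto_ell2_inner:
  assumes "(g \<longlongrightarrow> x) F" "(h \<longlongrightarrow> y) F"
  shows "((\<lambda>t. ell2_inner (g t) (h t)) \<longlongrightarrow> ell2_inner x y) F"
  unfolding ell2_inner_eq_Complex
  by (intro tendsto_Complex tendsto_inner assms
      bounded_linear.tendsto[OF bounded_linear_ell2_scaleC])

lemma ell2_inner_eqD:
  assumes "\<And>y. ell2_inner u y = ell2_inner v y"
  shows "u = v"
proof -
  have "inner (u - v) (u - v) = 0"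
    by (subst inner_diff_left) (simp add: inner_ell2_def assms)
  then show ?thesis by simp
qed

text \<open>Turns a rectangular partial sum of the double series into an inner product of truncated
  vectors, so that its convergence becomes a matter of continuity.\<close>

lift_definition ell2_truncate :: "nat \<Rightarrow> ell2 \<Rightarrow> ell2" is "\<lambda>N x k. if k < N then x k else 0"
proof -
  fix N and x :: "nat \<Rightarrow> complex"
  show "summable (\<lambda>k. (cmod (if k < N then x k else 0))\<^sup>2)"
    by (rule summable_finite[of "{..<N}"]) auto
qed

lemma tendsto_ell2_truncate: "(\<lambda>N. ell2_truncate N x) \<longlonglongrightarrow> x"
proof -
  have "(norm (x - ell2_truncate N x))\<^sup>2 = (\<Sum>k. (cmod (ell2_nth x (k + N)))\<^sup>2)" for N
  proof -
    have "(norm (x - ell2_truncate N x))\<^sup>2 = (\<Sum>k. (cmod (ell2_nth (x - ell2_truncate N x) (k + N)))\<^sup>2)"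
      unfolding norm_ell2_sq
      by (subst suminf_split_initial_segment[OF summable_ell2, of _ N])
        (simp add: minus_ell2.rep_eq ell2_truncate.rep_eq)
    then show ?thesis by (simp add: minus_ell2.rep_eq ell2_truncate.rep_eq)
  qed
  then have "(\<lambda>N. (norm (x - ell2_truncate N x))\<^sup>2) \<longlonglongrightarrow> 0"
    using suminf_exist_split2[OF summable_ell2] by simp
  then have "(\<lambda>N. sqrt ((norm (x - ell2_truncate N x))\<^sup>2)) \<longlonglongrightarrow> sqrt 0"
    by (rule tendsto_real_sqrt)
  then have "(\<lambda>N. norm (ell2_truncate N x - x)) \<longlonglongrightarrow> 0"
    by (simp add: norm_minus_commute)
  then show ?thesis
    using LIM_zero_iff tendsto_norm_zero_iff by blast
qed

text \<open>Prepares the fixed point theorem. The limit is built coordinatewise; the Cauchy bounds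
  survive because they pass to the limit in finite partial sums.\<close>

lemma complete_UNIV_ell2: "complete (UNIV :: ell2 set)"
proof (rule completeI)
  fix u :: "nat \<Rightarrow> ell2"
  assume "\<forall>n. u n \<in> UNIV" and u: "Cauchy u"
  have "Cauchy (\<lambda>n. ell2_nth (u n) k)" for k
  proof (rule CauchyI)
    fix e :: real assume "0 < e"
    then obtain N where "\<And>m n. m \<ge> N \<Longrightarrow> n \<ge> N \<Longrightarrow> norm (u m - u n) < e"
      using CauchyD[OF u] by blast
    then show "\<exists>N. \<forall>m\<ge>N. \<forall>n\<ge>N. norm (ell2_nth (u m) k - ell2_nth (u n) k) < e"
      using cmod_ell2_nth_le[of "u _ - u _" k]
      by (metis (no_types, lifting) minus_ell2.rep_eq le_less_trans)
  qed
  then have "\<forall>k. \<exists>l. (\<lambda>n. ell2_nth (u n) k) \<longlonglongrightarrow> l"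
    by (simp add: Cauchy_convergent convergent_def[symmetric])
  then obtain l where l: "\<And>k. (\<lambda>n. ell2_nth (u n) k) \<longlonglongrightarrow> l k" by metis
  \<comment> \<open>Used twice: with \<open>e = 1\<close> to see that \<open>l\<close> is
    square-summable, being \<open>u N1\<close> minus a vector of the space, and with
    \<open>e / 2\<close> for convergence in norm.\<close>
  have close: "\<exists>z. ell2_nth z = (\<lambda>k. ell2_nth (u m) k - l k) \<and> norm z \<le> e"
    if "0 < e" and N: "\<And>m n. m \<ge> N \<Longrightarrow> n \<ge> N \<Longrightarrow> norm (u m - u n) < e" "m \<ge> N" for e N m
  proof -
    have "(\<Sum>k<M. (cmod (ell2_nth (u m) k - l k))\<^sup>2) \<le> e\<^sup>2" for M
    proof (rule LIMSEQ_le_const2)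
      show "(\<lambda>n. \<Sum>k<M. (cmod (ell2_nth (u m) k - ell2_nth (u n) k))\<^sup>2)
          \<longlonglongrightarrow> (\<Sum>k<M. (cmod (ell2_nth (u m) k - l k))\<^sup>2)"
        by (intro tendsto_intros l)
      have "(\<Sum>k<M. (cmod (ell2_nth (u m) k - ell2_nth (u n) k))\<^sup>2) \<le> e\<^sup>2" if "n \<ge> N" for n
      proof -
        have "(\<Sum>k<M. (cmod (ell2_nth (u m) k - ell2_nth (u n) k))\<^sup>2) \<le> (norm (u m - u n))\<^sup>2"
          using sum_cmod_sq_le_norm_sq[of "{..<M}" "u m - u n"] by (simp add: minus_ell2.rep_eq)
        also have "\<dots> \<le> e\<^sup>2"
          using N(1)[OF N(2) that] by (intro power_mono) auto
        finally show ?thesis .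
      qed
      then show "\<exists>N. \<forall>n\<ge>N. (\<Sum>k<M. (cmod (ell2_nth (u m) k - ell2_nth (u n) k))\<^sup>2) \<le> e\<^sup>2"
        by blast
    qed
    from ell2_of_bounded_sums[OF this] \<open>0 < e\<close> show ?thesis
      by (metis less_imp_le)
  qed
  obtain N1 where N1: "\<And>m n. m \<ge> N1 \<Longrightarrow> n \<ge> N1 \<Longrightarrow> norm (u m - u n) < 1"
    using CauchyD[OF u, of 1] by auto
  obtain z where z: "ell2_nth z = (\<lambda>k. ell2_nth (u N1) k - l k)"
    using close[of 1 N1 N1] N1 by auto
  define x where "x = u N1 - z"
  have x: "ell2_nth x = l"
    by (simp add: x_def minus_ell2.rep_eq z)
  have "u \<longlonglongrightarrow> x"
  proof (rule LIMSEQ_I)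
    fix e :: real assume e: "0 < e"
    then obtain N where N: "\<And>m n. m \<ge> N \<Longrightarrow> n \<ge> N \<Longrightarrow> norm (u m - u n) < e / 2"
      using CauchyD[OF u, of "e / 2"] by auto
    have "norm (u m - x) < e" if m: "m \<ge> N" for m
    proof -
      obtain w where w: "ell2_nth w = (\<lambda>k. ell2_nth (u m) k - l k)" "norm w \<le> e / 2"
        using close[of "e / 2" N m] N m e by auto
      have "u m - x = w"
        by (rule ell2_eqI) (simp add: w minus_ell2.rep_eq x)
      then show ?thesis using w e by simp
    qed
    then show "\<exists>N. \<forall>m\<ge>N. norm (u m - x) < e" by blast
  qed
  then show "\<exists>x\<in>UNIV. u \<longlonglongrightarrow> x" by blast
qed

section \<open>Uniqueness of the generated operator and Schur's test\<close>

text \<open>Lets what is proved for the one operator built by Schur's test hold for every operator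
  generated by the matrix.\<close>

lemma generates_bounded_operator_unique:
  assumes "generates_bounded_operator a S" "generates_bounded_operator a T"
  shows "S = T"
proof (rule ext, rule ell2_inner_eqD)
  fix x y
  let ?s = "\<lambda>(N, M). \<Sum>k<N. \<Sum>j<M. a k j * ell2_nth x k * cnj (ell2_nth y j)"
  have "(?s \<longlongrightarrow> ell2_inner (S x) y) (sequentially \<times>\<^sub>F sequentially)"
    "(?s \<longlongrightarrow> ell2_inner (T x) y) (sequentially \<times>\<^sub>F sequentially)"
    using assms unfolding generates_bounded_operator_def by blast+
  then show "ell2_inner (S x) y = ell2_inner (T x) y"
    by (rule tendsto_unique[rotated]) (simp add: prod_filter_eq_bot)
qed

text \<open>Splitting each \<open>cmod (a k j)\<close> into two square roots, Cauchy-Schwarz leaves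
  one factor for the column bound; the other, summed over \<open>j\<close> after exchanging the
  sums, meets the row bound.\<close>

lemma schur_finite:
  fixes a :: "nat \<Rightarrow> nat \<Rightarrow> complex" and x :: "nat \<Rightarrow> complex"
  assumes fin: "finite K" "finite J"
    and row: "\<And>k. (\<Sum>j\<in>J. cmod (a k j)) \<le> C"
    and col: "\<And>j. (\<Sum>k\<in>K. cmod (a k j)) \<le> C"
  shows "(\<Sum>j\<in>J. (cmod (\<Sum>k\<in>K. a k j * x k))\<^sup>2) \<le> C\<^sup>2 * (\<Sum>k\<in>K. (cmod (x k))\<^sup>2)"
proof -
  have C: "0 \<le> C" using order_trans[OF sum_nonneg row[of 0]] by auto
  have *: "(cmod (\<Sum>k\<in>K. a k j * x k))\<^sup>2 \<le> C * (\<Sum>k\<in>K. cmod (a k j) * (cmod (x k))\<^sup>2)" for j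
  proof -
    have "cmod (\<Sum>k\<in>K. a k j * x k) \<le> (\<Sum>k\<in>K. sqrt (cmod (a k j)) * (sqrt (cmod (a k j)) * cmod (x k)))"
      by (rule sum_norm_le) (simp add: norm_mult mult.assoc[symmetric])
    then have "(cmod (\<Sum>k\<in>K. a k j * x k))\<^sup>2
        \<le> (\<Sum>k\<in>K. sqrt (cmod (a k j)) * (sqrt (cmod (a k j)) * cmod (x k)))\<^sup>2"
      by (intro power_mono) auto
    also have "\<dots> \<le> (\<Sum>k\<in>K. (sqrt (cmod (a k j)))\<^sup>2) * (\<Sum>k\<in>K. (sqrt (cmod (a k j)) * cmod (x k))\<^sup>2)"
      by (rule Cauchy_Schwarz_ineq_sum)
    also have "\<dots> = (\<Sum>k\<in>K. cmod (a k j)) * (\<Sum>k\<in>K. cmod (a k j) * (cmod (x k))\<^sup>2)"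
      by (simp add: power_mult_distrib)
    also have "\<dots> \<le> C * (\<Sum>k\<in>K. cmod (a k j) * (cmod (x k))\<^sup>2)"
      by (intro mult_right_mono col sum_nonneg) auto
    finally show ?thesis .
  qed
  have "(\<Sum>j\<in>J. (cmod (\<Sum>k\<in>K. a k j * x k))\<^sup>2)
      \<le> C * (\<Sum>j\<in>J. \<Sum>k\<in>K. cmod (a k j) * (cmod (x k))\<^sup>2)"
    unfolding sum_distrib_left[of C] by (rule sum_mono) (use * in \<open>simp add: sum_distrib_left\<close>)
  also have "(\<Sum>j\<in>J. \<Sum>k\<in>K. cmod (a k j) * (cmod (x k))\<^sup>2)
      = (\<Sum>k\<in>K. (\<Sum>j\<in>J. cmod (a k j)) * (cmod (x k))\<^sup>2)"
    by (subst sum.swap) (simp add: sum_distrib_right)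
  also have "C * \<dots> \<le> C * (\<Sum>k\<in>K. C * (cmod (x k))\<^sup>2)"
    by (intro mult_left_mono sum_mono mult_right_mono row C) auto
  also have "\<dots> = C\<^sup>2 * (\<Sum>k\<in>K. (cmod (x k))\<^sup>2)"
    by (simp add: sum_distrib_left power2_eq_square mult.assoc)
  finally show ?thesis .
qed

lemma schur_test:
  fixes a :: "nat \<Rightarrow> nat \<Rightarrow> complex"
  assumes row: "\<And>k J. finite J \<Longrightarrow> (\<Sum>j\<in>J. cmod (a k j)) \<le> C"
    and col: "\<And>j K. finite K \<Longrightarrow> (\<Sum>k\<in>K. cmod (a k j)) \<le> C"
  obtains S where "generates_bounded_operator a S" "\<And>x. norm (S x) \<le> C * norm x"
    "\<And>x j. (\<lambda>k. a k j * ell2_nth x k) sums ell2_nth (S x) j"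
proof -
  have C: "0 \<le> C" using row[of "{}"] by simp
  have summ: "summable (\<lambda>k. a k j * ell2_nth x k)" for x j
  proof (rule summable_norm_cancel, rule summable_comparison_test')
    have "summable (\<lambda>k. cmod (a k j))"
      by (rule summableI_nonneg_bounded[where x = C]) (auto simp: col)
    then show "summable (\<lambda>k. cmod (a k j) * norm x)" by (rule summable_mult2)
    show "norm (norm (a k j * ell2_nth x k)) \<le> cmod (a k j) * norm x" for k
      by (simp add: norm_mult mult_left_mono cmod_ell2_nth_le)
  qed
  \<comment> \<open>The pairing sums the first index against \<open>x\<close>, so coordinate
    \<open>j\<close> of the image uses column \<open>j\<close>. For fixed \<open>M\<close> the
    finite estimate passes to the limit in the number of summed \<open>k\<close>.\<close>
  have "\<exists>z. ell2_nth z = (\<lambda>j. \<Sum>k. a k j * ell2_nth x k) \<and> norm z \<le> C * norm x" for x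
  proof -
    have "(\<Sum>j<M. (cmod (\<Sum>k. a k j * ell2_nth x k))\<^sup>2) \<le> (C * norm x)\<^sup>2" for M
    proof (rule LIMSEQ_le_const2)
      show "(\<lambda>N. \<Sum>j<M. (cmod (\<Sum>k<N. a k j * ell2_nth x k))\<^sup>2)
          \<longlonglongrightarrow> (\<Sum>j<M. (cmod (\<Sum>k. a k j * ell2_nth x k))\<^sup>2)"
        by (intro tendsto_intros summable_LIMSEQ summ)
      have "(\<Sum>j<M. (cmod (\<Sum>k<N. a k j * ell2_nth x k))\<^sup>2) \<le> (C * norm x)\<^sup>2" for N
      proof -
        have "(\<Sum>j<M. (cmod (\<Sum>k<N. a k j * ell2_nth x k))\<^sup>2)
            \<le> C\<^sup>2 * (\<Sum>k<N. (cmod (ell2_nth x k))\<^sup>2)"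
          by (intro schur_finite row col) auto
        also have "\<dots> \<le> C\<^sup>2 * (norm x)\<^sup>2"
          by (intro mult_left_mono sum_cmod_sq_le_norm_sq) auto
        finally show ?thesis by (simp add: power_mult_distrib)
      qed
      then show "\<exists>N. \<forall>n\<ge>N. (\<Sum>j<M. (cmod (\<Sum>k<n. a k j * ell2_nth x k))\<^sup>2) \<le> (C * norm x)\<^sup>2"
        by blast
    qed
    from ell2_of_bounded_sums[OF this] C show ?thesis
      by (metis mult_nonneg_nonneg norm_ge_zero)
  qed
  then obtain S where S: "\<And>x. ell2_nth (S x) = (\<lambda>j. \<Sum>k. a k j * ell2_nth x k)"
    and S_le: "\<And>x. norm (S x) \<le> C * norm x" by metis
  have sums: "(\<lambda>k. a k j * ell2_nth x k) sums ell2_nth (S x) j" for x j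
    unfolding S by (rule summable_sums[OF summ])
  have lin: "bounded_linear S"
  proof (rule bounded_linear_intro[where K = C])
    show "S (x + y) = S x + S y" for x y
    proof (rule ell2_eqI)
      fix j
      have "(\<lambda>k. a k j * ell2_nth (x + y) k) sums (ell2_nth (S x) j + ell2_nth (S y) j)"
        using sums_add[OF sums[of j x] sums[of j y]] by (simp add: plus_ell2.rep_eq algebra_simps)
      then show "ell2_nth (S (x + y)) j = ell2_nth (S x + S y) j"
        using sums_unique2[OF sums] by (simp add: plus_ell2.rep_eq)
    qed
    show "S (r *\<^sub>R x) = r *\<^sub>R S x" for r x
    proof (rule ell2_eqI)
      fix j
      have "(\<lambda>k. a k j * ell2_nth (r *\<^sub>R x) k) sums (r *\<^sub>R ell2_nth (S x) j)"
        using sums_scaleR_right[OF sums[of j x], of r] by (simp add: scaleR_ell2.rep_eq)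
      then show "ell2_nth (S (r *\<^sub>R x)) j = ell2_nth (r *\<^sub>R S x) j"
        using sums_unique2[OF sums] by (simp add: scaleR_ell2.rep_eq)
    qed
  qed (simp add: S_le mult.commute)
  have clin: "S (ell2_scaleC c x) = ell2_scaleC c (S x)" for c x
  proof (rule ell2_eqI)
    fix j
    have "(\<lambda>k. a k j * ell2_nth (ell2_scaleC c x) k) sums (c * ell2_nth (S x) j)"
      using sums_mult[OF sums[of j x], of c] by (simp add: ell2_scaleC.rep_eq algebra_simps)
    then show "ell2_nth (S (ell2_scaleC c x)) j = ell2_nth (ell2_scaleC c (S x)) j"
      using sums_unique2[OF sums] by (simp add: ell2_scaleC.rep_eq)
  qed
  have rect: "(\<Sum>k<N. \<Sum>j<M. a k j * ell2_nth x k * cnj (ell2_nth y j))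
      = ell2_inner (S (ell2_truncate N x)) (ell2_truncate M y)" for N M x y
  proof -
    have "ell2_nth (S (ell2_truncate N x)) j = (\<Sum>k<N. a k j * ell2_nth x k)" for j
      unfolding S by (subst suminf_finite[of "{..<N}"]) (auto simp: ell2_truncate.rep_eq)
    then have "ell2_inner (S (ell2_truncate N x)) (ell2_truncate M y)
        = (\<Sum>j<M. (\<Sum>k<N. a k j * ell2_nth x k) * cnj (ell2_nth y j))"
      unfolding ell2_inner_def
      by (subst suminf_finite[of "{..<M}"]) (auto simp: ell2_truncate.rep_eq)
    then show ?thesis
      by (simp add: sum_distrib_right sum.swap[of _ "{..<N}"])
  qed
  have "((\<lambda>(N, M). \<Sum>k<N. \<Sum>j<M. a k j * ell2_nth x k * cnj (ell2_nth y j))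
      \<longlongrightarrow> ell2_inner (S x) y) (at_top \<times>\<^sub>F at_top)" for x y
    unfolding rect case_prod_beta
    by (intro tendsto_ell2_inner bounded_linear.tendsto[OF lin]
        filterlim_compose[OF tendsto_ell2_truncate] filterlim_fst filterlim_snd)
  then have "generates_bounded_operator a S"
    by (simp add: generates_bounded_operator_def bounded_clinear_ell2_def lin clin)
  then show thesis using S_le sums by (rule that)
qed

text \<open>The solution of \<open>x + T x = y\<close> is the fixed point of the contraction \<open>x \<mapsto> y - T x\<close>.\<close>

lemma has_bounded_inverse_identity_plus:
  assumes T: "bounded_clinear_ell2 T" "\<And>x. norm (T x) \<le> q * norm x" and q: "q < 1"
  shows "has_bounded_inverse (\<lambda>x. x + T x)"
proof -
  have T_lin: "bounded_linear T" and T_scaleC: "\<And>c x. T (ell2_scaleC c x) = ell2_scaleC c (T x)"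
    using T(1) by (auto simp: bounded_clinear_ell2_def)
  note T_add = linear_add[OF bounded_linear.linear[OF T_lin]]
    and T_scaleR = linear_scale[OF bounded_linear.linear[OF T_lin]]
    and T_diff = linear_diff[OF bounded_linear.linear[OF T_lin]]
  \<comment> \<open>Banach's theorem asks for a nonnegative contraction constant, while
    \<open>q\<close> may be negative.\<close>
  define p where "p = max q 0"
  have p: "0 \<le> p" "p < 1" using q by (auto simp: p_def)
  have T_le: "norm (T x) \<le> p * norm x" for x
    by (rule order_trans[OF T(2)]) (auto simp: p_def mult_right_mono)
  have ex: "\<exists>!x. x + T x = y" for y
  proof -
    have "\<exists>!x\<in>UNIV. y - T x = x"
    proof (rule Banach_fix[OF complete_UNIV_ell2 _ p])
      show "dist (y - T u) (y - T v) \<le> p * dist u v" for u v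
        using T_le[of "v - u"] by (simp add: dist_norm T_diff norm_minus_commute)
    qed auto
    moreover have "y - T x = x \<longleftrightarrow> x + T x = y" for x
      by (auto simp: algebra_simps)
    ultimately show ?thesis by simp
  qed
  define B where "B y = (THE x. x + T x = y)" for y
  have B: "B y + T (B y) = y" for y
    unfolding B_def by (rule theI'[OF ex])
  have uniq: "B y = x" if "x + T x = y" for x y
    using ex[of y] B[of y] that by blast
  have scaleC_add: "ell2_scaleC c (x + y) = ell2_scaleC c x + ell2_scaleC c y" for c x y
    using linear_add[OF bounded_linear.linear[OF bounded_linear_ell2_scaleC]] .
  have B_le: "norm (B y) \<le> norm y * (1 / (1 - p))" for y
  proof -
    have "norm (B y) \<le> norm y + norm (T (B y))"
      using norm_triangle_ineq4[of y "T (B y)"] B[of y] by (metis add_diff_cancel_right')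
    then have "norm (B y) * (1 - p) \<le> norm y"
      using T_le[of "B y"] by (simp add: algebra_simps)
    then show ?thesis using p by (simp add: field_simps)
  qed
  have "bounded_linear B"
  proof (rule bounded_linear_intro[where K = "1 / (1 - p)"])
    show "B (x + y) = B x + B y" for x y
      by (rule uniq) (metis B T_add add.assoc add.left_commute)
    show "B (r *\<^sub>R x) = r *\<^sub>R B x" for r x
      by (rule uniq) (metis B T_scaleR scaleR_add_right)
  qed (rule B_le)
  moreover have "B (ell2_scaleC c x) = ell2_scaleC c (B x)" for c x
    by (rule uniq) (metis B T_scaleC scaleC_add)
  ultimately have "bounded_clinear_ell2 B"
    by (simp add: bounded_clinear_ell2_def)
  then show ?thesis
    unfolding has_bounded_inverse_def using B uniq by blast
qed

text \<open>The test \<open>finite F\<close> makes the function total: an infinite set gives the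
  zero vector.\<close>

lift_definition ell2_indicator :: "nat set \<Rightarrow> ell2" is
  "\<lambda>F k. if finite F \<and> k \<in> F then 1 else 0"
proof -
  fix F :: "nat set"
  show "summable (\<lambda>k. (cmod (if finite F \<and> k \<in> F then 1 else 0))\<^sup>2)"
    by (rule summable_finite[of "if finite F then F else {}"]) (auto split: if_splits)
qed

lemma norm_ell2_indicator: "finite F \<Longrightarrow> (norm (ell2_indicator F))\<^sup>2 = real (card F)"
  unfolding norm_ell2_sq by (subst suminf_finite[of F]) (auto simp: ell2_indicator.rep_eq)

text \<open>At the indicator of a finite set the rectangular partial sums of the quadratic form are
  constant once both bounds pass \<open>F\<close>, so their limit is the finite double sum.
  Cauchy-Schwarz finishes, as the squared norm of the indicator is \<open>card F\<close>.\<close>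

lemma generates_bounded_operator_sum_le:
  assumes S: "generates_bounded_operator a S" and F: "finite F"
  shows "Re (\<Sum>k\<in>F. \<Sum>j\<in>F. a k j) \<le> onorm S * real (card F)"
proof -
  let ?x = "ell2_indicator F"
  have lin: "bounded_linear S"
    using S by (simp add: generates_bounded_operator_def bounded_clinear_ell2_def)
  let ?s = "\<lambda>(N, M). \<Sum>k<N. \<Sum>j<M. a k j * ell2_nth ?x k * cnj (ell2_nth ?x j)"
  obtain n where n: "F \<subseteq> {..<n}"
    using finite_nat_set_iff_bounded[of F] F by auto
  have const: "?s (N, M) = (\<Sum>k\<in>F. \<Sum>j\<in>F. a k j)" if "N \<ge> n" "M \<ge> n" for N M
  proof -
    have "?s (N, M) = (\<Sum>k\<in>F. \<Sum>j<M. a k j * ell2_nth ?x k * cnj (ell2_nth ?x j))"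
      unfolding prod.case using n that F
      by (intro sum.mono_neutral_right) (auto simp: ell2_indicator.rep_eq)
    also have "\<dots> = (\<Sum>k\<in>F. \<Sum>j\<in>F. a k j)"
      using n that F
      by (intro sum.cong refl sum.mono_neutral_cong_right) (auto simp: ell2_indicator.rep_eq)
    finally show ?thesis .
  qed
  have "\<forall>\<^sub>F p in sequentially \<times>\<^sub>F sequentially. ?s p = (\<Sum>k\<in>F. \<Sum>j\<in>F. a k j)"
    using eventually_prodI[OF eventually_ge_at_top[of n] eventually_ge_at_top[of n]]
  proof eventually_elim
    case (elim p)
    then show ?case using const[of "fst p" "snd p"] by (simp only: prod.collapse)
  qed
  then have "(?s \<longlongrightarrow> (\<Sum>k\<in>F. \<Sum>j\<in>F. a k j)) (sequentially \<times>\<^sub>F sequentially)"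
    by (rule tendsto_eventually)
  moreover have "(?s \<longlongrightarrow> ell2_inner (S ?x) ?x) (sequentially \<times>\<^sub>F sequentially)"
    using S by (simp add: generates_bounded_operator_def)
  ultimately have "(\<Sum>k\<in>F. \<Sum>j\<in>F. a k j) = ell2_inner (S ?x) ?x"
    by (rule tendsto_unique[rotated]) (simp add: prod_filter_eq_bot)
  then have "Re (\<Sum>k\<in>F. \<Sum>j\<in>F. a k j) = inner (S ?x) ?x"
    by (simp add: inner_ell2_def)
  also have "\<dots> \<le> norm (S ?x) * norm ?x"
    by (rule norm_cauchy_schwarz)
  also have "\<dots> \<le> onorm S * norm ?x * norm ?x"
    by (intro mult_right_mono onorm lin) auto
  also have "\<dots> = onorm S * real (card F)"
    using norm_ell2_indicator[OF F] by (simp add: power2_eq_square mult.assoc)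
  finally show ?thesis .
qed

section \<open>Moments of decreasing functions\<close>

lemma power_diff_le:
  fixes a b :: real
  assumes "0 \<le> b" "b \<le> a"
  shows "a ^ n - b ^ n \<le> real n * (a - b) * a ^ (n - 1)"
proof -
  have "(\<Sum>i<n. b ^ (n - Suc i) * a ^ i) \<le> (\<Sum>i<n. a ^ (n - 1))"
  proof (rule sum_mono)
    fix i assume "i \<in> {..<n}"
    then have "b ^ (n - Suc i) * a ^ i \<le> a ^ (n - Suc i) * a ^ i"
      using assms by (intro mult_right_mono power_mono) auto
    also have "\<dots> = a ^ (n - 1)"
      using \<open>i \<in> {..<n}\<close> by (simp add: power_add[symmetric])
    finally show "b ^ (n - Suc i) * a ^ i \<le> a ^ (n - 1)" .
  qed
  then have "(a - b) * (\<Sum>i<n. b ^ (n - Suc i) * a ^ i) \<le> (a - b) * (real n * a ^ (n - 1))"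
    using assms by (intro mult_left_mono) auto
  then show ?thesis
    by (simp add: power_diff_sumr2 mult_ac)
qed

text \<open>The right-hand side is \<open>n\<close> times the integral of \<open>t^(n - 1)\<close>
  over \<open>[k - 1, k]\<close>. This turns a shell count into a moment integral, and the second
  factor \<open>d\<close> of the norm bound arises here.\<close>

lemma power_diff_ge:
  fixes k :: real
  assumes "1 \<le> k" "0 < n"
  shows "k ^ (n - 1) \<le> k ^ n - (k - 1) ^ n"
proof -
  obtain m where n: "n = Suc m" using assms by (cases n) auto
  have "(k - 1) * (k - 1) ^ m \<le> (k - 1) * k ^ m"
    using assms by (intro mult_left_mono power_mono) auto
  then show ?thesis by (simp add: n algebra_simps)
qed

locale decreasing_profile =
  fixes f :: "real \<Rightarrow> real"
  assumes f_nonneg: "\<And>t. t \<ge> 0 \<Longrightarrow> f t \<ge> 0"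
    and f_decr: "\<And>s t. 0 \<le> s \<Longrightarrow> s \<le> t \<Longrightarrow> f t \<le> f s"
begin

definition moment :: "nat \<Rightarrow> real \<Rightarrow> real" where
  "moment d t = t ^ (d - 1) * f t"

lemma moment_nonneg: "0 \<le> t \<Longrightarrow> 0 \<le> moment d t"
  by (simp add: moment_def f_nonneg)

text \<open>Nothing is known about \<open>f\<close> at negative arguments;
  \<open>f (max 0 t)\<close> is decreasing on the whole line, hence Borel, and agrees with
  \<open>f\<close> on \<open>A\<close>.\<close>

lemma borel_measurable_moment:
  "A \<in> sets borel \<Longrightarrow> A \<subseteq> {0..} \<Longrightarrow> set_borel_measurable borel A (moment d)"
proof -
  assume A: "A \<in> sets borel" "A \<subseteq> {0..}"
  have "mono (\<lambda>t. - f (max 0 t))"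
    by (auto intro!: monoI f_decr)
  then have "(\<lambda>t. - (- f (max 0 t))) \<in> borel_measurable borel"
    by (intro borel_measurable_uminus borel_measurable_mono)
  then have "(\<lambda>t. f (max 0 t)) \<in> borel_measurable borel" by simp
  then have "(\<lambda>t. indicator A t *\<^sub>R (t ^ (d - 1) * f (max 0 t))) \<in> borel_measurable borel"
    using A by measurable
  also have "(\<lambda>t. indicator A t *\<^sub>R (t ^ (d - 1) * f (max 0 t))) = (\<lambda>t. indicator A t *\<^sub>R moment d t)"
    using A by (auto simp: fun_eq_iff moment_def indicator_def max_def)
  finally show ?thesis by (simp add: set_borel_measurable_def)
qed

lemma moment_le:
  assumes "0 \<le> a" "t \<in> {a..b}"
  shows "moment d t \<le> b ^ (d - 1) * f a"
  unfolding moment_def using assms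
  by (intro mult_mono power_mono f_decr f_nonneg) auto

lemma set_integrable_moment:
  assumes "0 \<le> a"
  shows "set_integrable lborel {a..b} (moment d)"
  unfolding set_integrable_def
proof (rule Bochner_Integration.integrable_bound)
  show "integrable lborel (\<lambda>t. indicator {a..b} t *\<^sub>R (b ^ (d - 1) * f a))"
    using borel_integrable_atLeastAtMost'[of a b "\<lambda>_. b ^ (d - 1) * f a"]
    by (simp add: set_integrable_def)
  show "(\<lambda>t. indicator {a..b} t *\<^sub>R moment d t) \<in> borel_measurable lborel"
    using borel_measurable_moment[of "{a..b}" d] assms by (simp add: set_borel_measurable_def)
  show "AE t in lborel. norm (indicator {a..b} t *\<^sub>R moment d t)
      \<le> norm (indicator {a..b} t *\<^sub>R (b ^ (d - 1) * f a))"
    using assms moment_le[of a _ b d] moment_nonneg[of _ d]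
    by (auto simp: indicator_def intro!: AE_I2 order_trans[OF _ abs_ge_self])
qed

lemma integrable_on_moment: "0 \<le> a \<Longrightarrow> moment d integrable_on {a..b}"
  using set_borel_integral_eq_integral(1)[OF set_integrable_moment] .

lemma integral_moment_ge:
  assumes "0 \<le> a" "a \<le> b" "0 < d"
  shows "f b * ((b ^ d - a ^ d) / real d) \<le> integral {a..b} (moment d)"
proof -
  have "((\<lambda>t. t ^ (d - 1)) has_integral (b ^ d / real d - a ^ d / real d)) {a..b}"
    using assms
    by (intro fundamental_theorem_of_calculus)
      (auto intro!: derivative_eq_intros simp: has_real_derivative_iff_has_vector_derivative[symmetric])
  then have "((\<lambda>t. f b * t ^ (d - 1)) has_integral f b * (b ^ d / real d - a ^ d / real d)) {a..b}"
    by (rule has_integral_mult_right)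
  moreover have "(moment d has_integral integral {a..b} (moment d)) {a..b}"
    using integrable_on_moment[OF assms(1)] by (rule integrable_integral)
  ultimately have "f b * (b ^ d / real d - a ^ d / real d) \<le> integral {a..b} (moment d)"
  proof (rule has_integral_le)
    fix t assume "t \<in> {a..b}"
    then show "f b * t ^ (d - 1) \<le> moment d t"
      unfolding moment_def using assms
      by (subst mult.commute) (auto intro!: mult_left_mono f_decr)
  qed
  then show ?thesis by (simp add: diff_divide_distrib)
qed

lemma integral_moment_le:
  assumes "0 \<le> a" "a \<le> b"
  shows "integral {a..b} (moment d) \<le> b ^ (d - 1) * f a * (b - a)"
proof -
  have "integral {a..b} (moment d) \<le> integral {a..b} (\<lambda>t. b ^ (d - 1) * f a)"
    using assms by (intro integral_le integrable_on_moment moment_le) auto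
  then show ?thesis using assms by (simp add: mult_ac)
qed

lemma sum_integral_moment:
  assumes "0 \<le> s" "m \<le> n"
  shows "(\<Sum>k=m..<n. integral {real k * s..real (Suc k) * s} (moment d))
    = integral {real m * s..real n * s} (moment d)"
  using assms(2)
proof (induction n rule: dec_induct)
  case (step n)
  have "integral {real m * s..real n * s} (moment d) + integral {real n * s..real (Suc n) * s} (moment d)
      = integral {real m * s..real (Suc n) * s} (moment d)"
    using assms(1) step.hyps
    by (intro Henstock_Kurzweil_Integration.integral_combine integrable_on_moment mult_right_mono) auto
  then show ?case using step by simp
qed simp

lemma integral_moment_le_total:
  assumes "set_integrable lborel {0..} (moment d)" "0 \<le> a"
  shows "integral {a..b} (moment d) \<le> (LBINT t:{0..}. moment d t)"
  unfolding set_borel_integral_eq_integral(2)[OF assms(1)]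
  using assms set_borel_integral_eq_integral(1)[OF assms(1)]
  by (intro integral_subset_le integrable_on_moment) (auto simp: moment_nonneg)

section \<open>Off-diagonal row sums of the Schoenberg matrix\<close>

lemma row_sum_le:
  fixes X :: "nat \<Rightarrow> real ^ 'n"
  assumes int: "set_integrable lborel {0..} (moment d)"
    and d: "d = dim (span (range X))" "0 < d"
    and s: "0 < s" "\<And>i j. i \<noteq> j \<Longrightarrow> s \<le> norm (X i - X j)"
    and J: "finite J" "i \<notin> J"
  shows "(\<Sum>j\<in>J. f (norm (X j - X i))) \<le> (real d)\<^sup>2 * (5 / s) ^ d * (LBINT t:{0..}. moment d t)"
proof -
  define I where "I = (LBINT t:{0..}. moment d t)"
  \<comment> \<open>Shell index shifted down by one: for \<open>j\<close> in \<open>J\<close> the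
    distance is at least \<open>s\<close>, so the floor is at least \<open>1\<close> and the natural
    subtraction is exact. Shell \<open>Suc k\<close> is then charged to
    \<open>[k s, (k + 1) s]\<close>.\<close>
  define \<kappa> where "\<kappa> j = nat \<lfloor>norm (X j - X i) / s\<rfloor> - 1" for j
  have \<kappa>: "real (Suc (\<kappa> j)) * s \<le> norm (X j - X i)" "norm (X j - X i) \<le> (real (Suc (\<kappa> j)) + 1) * s"
    if "j \<in> J" for j
  proof -
    have "s \<le> norm (X j - X i)" using s(2)[of j i] J that by auto
    then have "1 \<le> norm (X j - X i) / s" using s by simp
    then have "1 \<le> nat \<lfloor>norm (X j - X i) / s\<rfloor>" by linarith
    then have "real (Suc (\<kappa> j)) = real_of_int \<lfloor>norm (X j - X i) / s\<rfloor>"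
      unfolding \<kappa>_def by linarith
    then have "real (Suc (\<kappa> j)) \<le> norm (X j - X i) / s" "norm (X j - X i) / s \<le> real (Suc (\<kappa> j)) + 1"
      by linarith+
    then show "real (Suc (\<kappa> j)) * s \<le> norm (X j - X i)"
      "norm (X j - X i) \<le> (real (Suc (\<kappa> j)) + 1) * s"
      using s(1) by (simp_all add: field_simps)
  qed
  define C where "C = 4 * real d * 5 ^ (d - 1)"
  have shell: "(\<Sum>j | j \<in> J \<and> \<kappa> j = k. f (norm (X j - X i)))
      \<le> C * real d / s ^ d * integral {real k * s..real (Suc k) * s} (moment d)" for k
  proof -
    define K where "K = real (Suc k)"
    have K: "1 \<le> K" by (simp add: K_def)
    define Jk where "Jk = {j. j \<in> J \<and> \<kappa> j = k}"
    have fin: "finite Jk" using J by (simp add: Jk_def)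
    \<comment> \<open>A hole of radius \<open>(K - 1 / 2) s\<close> leaves room for balls of radius
      \<open>s / 2\<close> about points at distance at least \<open>K s\<close>.\<close>
    have "real (card Jk) * (s / 2) ^ d \<le> ((K + 1) * s + s / 2) ^ d - ((K - 1 / 2) * s) ^ d"
    proof (rule card_shell_le[OF d s fin])
      show "0 \<le> (K - 1 / 2) * s" "(K - 1 / 2) * s \<le> (K + 1) * s"
        using K s(1) by (auto intro!: mult_right_mono)
      fix j assume "j \<in> Jk"
      then show "norm (X j - X i) \<le> (K + 1) * s"
        "(K - 1 / 2) * s = 0 \<or> (K - 1 / 2) * s + s / 2 \<le> norm (X j - X i)"
        using \<kappa>[of j] by (auto simp: Jk_def K_def algebra_simps)
    qed
    also have "(K + 1) * s + s / 2 = (2 * K + 3) * (s / 2)" by (simp add: algebra_simps)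
    also have "(K - 1 / 2) * s = (2 * K - 1) * (s / 2)" by (simp add: algebra_simps)
    also have "((2 * K + 3) * (s / 2)) ^ d - ((2 * K - 1) * (s / 2)) ^ d
        = ((2 * K + 3) ^ d - (2 * K - 1) ^ d) * (s / 2) ^ d"
      unfolding power_mult_distrib by (simp add: left_diff_distrib)
    finally have "real (card Jk) \<le> (2 * K + 3) ^ d - (2 * K - 1) ^ d"
      by (rule mult_right_le_imp_le) (use s in auto)
    also have "\<dots> \<le> real d * (2 * K + 3 - (2 * K - 1)) * (2 * K + 3) ^ (d - 1)"
      using K by (intro power_diff_le) auto
    also have "\<dots> = 4 * real d * (2 * K + 3) ^ (d - 1)" by simp
    also have "\<dots> \<le> 4 * real d * (5 * K) ^ (d - 1)"
      using K by (intro mult_left_mono power_mono) auto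
    also have "\<dots> = C * K ^ (d - 1)"
      by (simp add: C_def power_mult_distrib)
    also have "\<dots> \<le> C * (K ^ d - (K - 1) ^ d)"
      using K d by (intro mult_left_mono power_diff_ge) (auto simp: C_def)
    finally have card: "real (card Jk) \<le> C * (K ^ d - (K - 1) ^ d)" .
    have "(\<Sum>j\<in>Jk. f (norm (X j - X i))) \<le> (\<Sum>j\<in>Jk. f (K * s))"
      using \<kappa> s K by (intro sum_mono f_decr) (auto simp: Jk_def K_def)
    also have "\<dots> = real (card Jk) * f (K * s)" by simp
    also have "\<dots> \<le> C * (K ^ d - (K - 1) ^ d) * f (K * s)"
      using card K s by (intro mult_right_mono f_nonneg) auto
    also have "\<dots> = C * real d / s ^ d * (f (K * s) * (((K * s) ^ d - ((K - 1) * s) ^ d) / real d))"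
    proof -
      have "((K * s) ^ d - ((K - 1) * s) ^ d) / real d = (K ^ d - (K - 1) ^ d) * (s ^ d / real d)"
        unfolding power_mult_distrib by (simp add: left_diff_distrib)
      then show ?thesis using s(1) d(2) by simp
    qed
    also have "\<dots> \<le> C * real d / s ^ d * integral {(K - 1) * s..K * s} (moment d)"
      using K s d(2) by (intro mult_left_mono integral_moment_ge mult_right_mono) (auto simp: C_def)
    finally show ?thesis by (simp add: Jk_def K_def)
  qed
  obtain M where M: "\<forall>j\<in>J. \<kappa> j < M"
    using finite_nat_set_iff_bounded[of "\<kappa> ` J"] J by auto
  have "(\<Sum>j\<in>J. f (norm (X j - X i))) = (\<Sum>k=0..<M. \<Sum>j | j \<in> J \<and> \<kappa> j = k. f (norm (X j - X i)))"
    by (rule sum.group[symmetric]) (use J M in auto)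
  also have "\<dots> \<le> (\<Sum>k=0..<M. C * real d / s ^ d * integral {real k * s..real (Suc k) * s} (moment d))"
    by (intro sum_mono shell)
  also have "\<dots> = C * real d / s ^ d * integral {0..real M * s} (moment d)"
    unfolding sum_distrib_left[symmetric]
    using sum_integral_moment[of s 0 M d] s(1) by simp
  also have "\<dots> \<le> C * real d / s ^ d * I"
    unfolding I_def using s
    by (intro mult_left_mono integral_moment_le_total int) (auto simp: C_def)
  also have "\<dots> \<le> (real d)\<^sup>2 * (5 / s) ^ d * I"
  proof (rule mult_right_mono)
    show "0 \<le> I" unfolding I_def set_lebesgue_integral_def
      by (intro integral_nonneg_AE AE_I2) (auto simp: indicator_def moment_nonneg)
    \<comment> \<open>Here \<open>C * d\<close> is \<open>4 / 5\<close> of \<open>d^2 * 5^d\<close>,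
      so a fifth of the bound is slack.\<close>
    have "(5::real) ^ d = 5 * 5 ^ (d - 1)" using d(2) by (cases d) auto
    then have "C * real d / s ^ d = 4 / 5 * ((real d)\<^sup>2 * (5 / s) ^ d)"
      by (simp add: C_def power_divide power2_eq_square)
    also have "\<dots> \<le> 1 * ((real d)\<^sup>2 * (5 / s) ^ d)"
      using s by (intro mult_right_mono) auto
    finally show "C * real d / s ^ d \<le> (real d)\<^sup>2 * (5 / s) ^ d" by simp
  qed
  finally show ?thesis by (simp add: I_def)
qed

section \<open>Integrability from bounded truncations, and lower bounds for row sums\<close>

text \<open>Monotone convergence along \<open>[0, M \<delta>]\<close>; the integrals increase with
  \<open>M\<close>, so a bound for large \<open>M\<close> bounds them all.\<close>

lemma set_integrable_moment_if_bounded: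
  assumes \<delta>: "0 < \<delta>" and K: "\<And>M. M \<ge> M0 \<Longrightarrow> integral {0..real M * \<delta>} (moment d) \<le> K"
  shows "set_integrable lborel {0..} (moment d)"
proof -
  let ?g = "\<lambda>(M :: nat) t. indicator {0..real M * \<delta>} t *\<^sub>R moment d t"
  have int: "integrable lborel (?g M)" for M
    using set_integrable_moment[of 0 "real M * \<delta>" d] by (simp add: set_integrable_def)
  have eq: "integral\<^sup>L lborel (?g M) = integral {0..real M * \<delta>} (moment d)" for M
    using set_borel_integral_eq_integral(2)[OF set_integrable_moment[of 0 "real M * \<delta>" d]]
    by (simp add: set_lebesgue_integral_def)
  have mono: "integral {0..real M * \<delta>} (moment d) \<le> integral {0..real N * \<delta>} (moment d)"
    if "M \<le> N" for M N
    using that \<delta> by (intro integral_subset_le integrable_on_moment) (auto simp: moment_nonneg)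
  have "integral {0..real M * \<delta>} (moment d) \<le> K" for M
    using mono[of M "max M M0"] K[of "max M M0"] by simp
  then obtain L where L: "(\<lambda>M. integral {0..real M * \<delta>} (moment d)) \<longlonglongrightarrow> L"
    using incseq_convergent[of "\<lambda>M. integral {0..real M * \<delta>} (moment d)" K] mono
    unfolding incseq_def by blast
  show ?thesis
    unfolding set_integrable_def
  proof (rule integrable_monotone_convergence[where f = ?g])
    show "AE t in lborel. mono (\<lambda>M. ?g M t)"
    proof (intro AE_I2 monoI)
      fix t and M N :: nat assume "M \<le> N"
      then have "real M * \<delta> \<le> real N * \<delta>" using \<delta> by simp
      then show "?g M t \<le> ?g N t" by (auto simp: indicator_def moment_nonneg)
    qed
    show "AE t in lborel. (\<lambda>M. ?g M t) \<longlonglongrightarrow> indicator {0..} t *\<^sub>R moment d t"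
    proof (intro AE_I2 tendsto_eventually)
      fix t
      obtain n :: nat where "t / \<delta> \<le> real n" using real_arch_simple by blast
      then have n: "t \<le> real n * \<delta>" using \<delta> by (simp add: field_simps)
      show "\<forall>\<^sub>F M in sequentially. ?g M t = indicator {0..} t *\<^sub>R moment d t"
        using eventually_ge_at_top[of n]
      proof eventually_elim
        case (elim M)
        then have "real n * \<delta> \<le> real M * \<delta>" using \<delta> by simp
        with n show ?case by (auto simp: indicator_def)
      qed
    qed
    show "(\<lambda>M. integral\<^sup>L lborel (?g M)) \<longlonglongrightarrow> L" unfolding eq by (rule L)
    show "(\<lambda>t. indicator {0..} t *\<^sub>R moment d t) \<in> borel_measurable lborel"
      using borel_measurable_moment[of "{0..}" d] by (simp add: set_borel_measurable_def)
  qed (rule int)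
qed

text \<open>Shells of width \<open>\<delta>\<close> are disjoint. In shell \<open>l\<close> the
  values of \<open>f\<close> are at least \<open>f ((l + 1) \<delta>)\<close>, which in turn
  dominates \<open>f\<close> on the next interval; hence the integral sits one step further out than
  the shells.\<close>

lemma regular_sum_ge:
  fixes Y :: "nat \<Rightarrow> real ^ 'n"
  assumes c: "0 < c" and \<delta>: "0 < \<delta>"
    and reg: "\<And>r j. r \<ge> r0 \<Longrightarrow>
      c * r ^ (d - 1) \<le> real (card {k. r \<le> norm (Y k - Y j) \<and> norm (Y k - Y j) < r + \<delta>})"
    and fin: "\<And>j R. finite {k. norm (Y k - Y j) < R}"
    and m: "1 \<le> m" "r0 \<le> real m * \<delta>" "m \<le> M"
  shows "c / (3 ^ (d - 1) * \<delta>) * integral {real (Suc m) * \<delta>..real (Suc M) * \<delta>} (moment d)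
    \<le> (\<Sum>k | norm (Y k - Y j) < real M * \<delta>. f (norm (Y k - Y j)))"
proof -
  let ?r = "\<lambda>k. norm (Y k - Y j)"
  define A where "A l = {k. real l * \<delta> \<le> ?r k \<and> ?r k < real l * \<delta> + \<delta>}" for l :: nat
  have A_fin: "finite (A l)" for l
    by (rule finite_subset[OF _ fin[of j "real l * \<delta> + \<delta>"]]) (auto simp: A_def)
  have shell: "c / (3 ^ (d - 1) * \<delta>) * integral {real (Suc l) * \<delta>..real (Suc (Suc l)) * \<delta>} (moment d)
      \<le> (\<Sum>k\<in>A l. f (?r k))" if l: "m \<le> l" for l
  proof -
    have l1: "1 \<le> real l" and r0: "r0 \<le> real l * \<delta>"
      using l m \<delta> by (auto intro: order_trans[OF m(2)])
    have "integral {real (Suc l) * \<delta>..real (Suc (Suc l)) * \<delta>} (moment d)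
        \<le> (real (Suc (Suc l)) * \<delta>) ^ (d - 1) * f (real (Suc l) * \<delta>)
            * (real (Suc (Suc l)) * \<delta> - real (Suc l) * \<delta>)"
      using \<delta> by (intro integral_moment_le mult_right_mono) auto
    also have "real (Suc (Suc l)) * \<delta> - real (Suc l) * \<delta> = \<delta>" by (simp add: algebra_simps)
    \<comment> \<open>The \<open>3\<close> comes from \<open>l + 2 <= 3 l\<close>, valid for
      \<open>l >= 1\<close>.\<close>
    also have "(real (Suc (Suc l)) * \<delta>) ^ (d - 1) * f (real (Suc l) * \<delta>) * \<delta>
        \<le> (3 * (real l * \<delta>)) ^ (d - 1) * f (real (Suc l) * \<delta>) * \<delta>"
      using l1 \<delta> by (intro mult_right_mono power_mono f_nonneg) (auto simp: mult.assoc[symmetric])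
    also have "\<dots> = 3 ^ (d - 1) * \<delta> * ((real l * \<delta>) ^ (d - 1) * f (real (Suc l) * \<delta>))"
      by (simp only: power_mult_distrib mult_ac)
    finally have "c / (3 ^ (d - 1) * \<delta>) * integral {real (Suc l) * \<delta>..real (Suc (Suc l)) * \<delta>} (moment d)
        \<le> c / (3 ^ (d - 1) * \<delta>) * (3 ^ (d - 1) * \<delta> * ((real l * \<delta>) ^ (d - 1) * f (real (Suc l) * \<delta>)))"
      using c \<delta> by (intro mult_left_mono) auto
    also have "\<dots> = c * (real l * \<delta>) ^ (d - 1) * f (real (Suc l) * \<delta>)"
      using \<delta> by simp
    also have "\<dots> \<le> real (card (A l)) * f (real (Suc l) * \<delta>)"
      using reg[OF r0, of j] \<delta> by (intro mult_right_mono f_nonneg) (auto simp: A_def)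
    also have "\<dots> = (\<Sum>k\<in>A l. f (real (Suc l) * \<delta>))" by simp
    also have "\<dots> \<le> (\<Sum>k\<in>A l. f (?r k))"
      by (intro sum_mono f_decr) (auto simp: A_def algebra_simps)
    finally show ?thesis .
  qed
  have "integral {real (Suc m) * \<delta>..real (Suc M) * \<delta>} (moment d)
      = (\<Sum>l=m..<M. integral {real (Suc l) * \<delta>..real (Suc (Suc l)) * \<delta>} (moment d))"
    using sum_integral_moment[of \<delta> "Suc m" "Suc M" d] \<delta> m(3)
    unfolding sum.shift_bounds_Suc_ivl by simp
  then have "c / (3 ^ (d - 1) * \<delta>) * integral {real (Suc m) * \<delta>..real (Suc M) * \<delta>} (moment d)
      \<le> (\<Sum>l=m..<M. \<Sum>k\<in>A l. f (?r k))"
    by (simp only: sum_distrib_left) (intro sum_mono shell, simp)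
  also have "\<dots> = (\<Sum>k\<in>(\<Union>l\<in>{m..<M}. A l). f (?r k))"
  proof (rule sum.UNION_disjoint[symmetric])
    have "l = l'" if "k \<in> A l" "k \<in> A l'" for k l l'
    proof -
      have "real l * \<delta> < (real l' + 1) * \<delta>" "real l' * \<delta> < (real l + 1) * \<delta>"
        using that by (auto simp: A_def algebra_simps)
      then show ?thesis using \<delta> by auto
    qed
    then show "\<forall>l\<in>{m..<M}. \<forall>l'\<in>{m..<M}. l \<noteq> l' \<longrightarrow> A l \<inter> A l' = {}" by blast
  qed (auto simp: A_fin)
  also have "\<dots> \<le> (\<Sum>k | ?r k < real M * \<delta>. f (?r k))"
  proof (rule sum_mono2[OF fin])
    show "(\<Union>l\<in>{m..<M}. A l) \<subseteq> {k. ?r k < real M * \<delta>}"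
    proof
      fix k assume "k \<in> (\<Union>l\<in>{m..<M}. A l)"
      then obtain l where l: "l < M" "?r k < real l * \<delta> + \<delta>" by (auto simp: A_def)
      then have "(real l + 1) * \<delta> \<le> real M * \<delta>" using \<delta> by (intro mult_right_mono) auto
      then show "k \<in> {k. ?r k < real M * \<delta>}" using l by (auto simp: algebra_simps)
    qed
  qed (simp add: f_nonneg)
  finally show ?thesis .
qed

end

section \<open>Schoenberg operators\<close>

context decreasing_profile
begin

text \<open>Testing the operator on the indicator of the points within distance \<open>2 M \<delta>\<close> of the origin
  bounds the average row sum over radius \<open>M \<delta>\<close> by the norm times the ratio of the point counts of
  the two balls. That ratio stays bounded by packing from above and regularity from below.\<close>

lemma set_integrable_moment_if_bounded_operator:
  fixes Y :: "nat \<Rightarrow> real ^ 'n"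
  assumes Y: "delta_regular \<delta> Y" and d: "d = dim (span (range Y))" "0 < d"
    and S: "generates_bounded_operator (schoenberg_matrix Y f) S"
  shows "set_integrable lborel {0..} (moment d)"
proof -
  \<comment> \<open>For the constant profile the row-sum lower bound counts points, which yields the
    growth of balls from below.\<close>
  interpret one: decreasing_profile "\<lambda>_. 1" by standard auto
  define s where "s = separation Y"
  have s: "0 < s" "\<And>i j. i \<noteq> j \<Longrightarrow> s \<le> norm (Y i - Y j)"
    using Y separation_le_norm[of _ _ Y] by (auto simp: s_def delta_regular_def separated_def)
  from Y obtain c r0 where \<delta>: "0 < \<delta>" and c: "0 < c" and Y0: "Y 0 = 0"
    and reg: "\<And>r j. r \<ge> r0 \<Longrightarrow>
      c * r ^ (d - 1) \<le> real (card {k. r \<le> norm (Y k - Y j) \<and> norm (Y k - Y j) < r + \<delta>})"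
    unfolding delta_regular_def d(1) by blast
  have fin: "finite {k. norm (Y k - Y j) < R}" for j R
    using card_ball_le(1)[OF d s, of "max R 0" j] by (rule rev_finite_subset) auto
  obtain m :: nat where m: "1 \<le> m" "r0 \<le> real m * \<delta>"
  proof -
    obtain n :: nat where "r0 / \<delta> \<le> real n" using real_arch_simple by blast
    then have "r0 \<le> real n * \<delta>" using \<delta> by (simp add: field_simps)
    also have "\<dots> \<le> real (Suc n) * \<delta>" using \<delta> by simp
    finally show thesis by (intro that[of "Suc n"]) auto
  qed
  define B where "B R = {k. norm (Y k) < R}" for R
  have B_fin: "finite (B R)" for R
    using fin[of 0 R] by (simp add: B_def Y0)
  define \<kappa> where "\<kappa> = c / (3 ^ (d - 1) * \<delta>)"
  have \<kappa>: "0 < \<kappa>" using c \<delta> by (simp add: \<kappa>_def)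
  define J where "J M = integral {real (Suc m) * \<delta>..real (Suc M) * \<delta>} (moment d)" for M
  have J_nonneg: "0 \<le> J M" for M
    unfolding J_def
  proof (intro Henstock_Kurzweil_Integration.integral_nonneg integrable_on_moment moment_nonneg)
    show "0 \<le> real (Suc m) * \<delta>" using \<delta> by simp
    then show "0 \<le> t" if "t \<in> {real (Suc m) * \<delta>..real (Suc M) * \<delta>}" for t
      using that by (auto intro: order_trans)
  qed
  define \<Lambda> where "\<Lambda> = onorm S"
  have \<Lambda>: "0 \<le> \<Lambda>"
    using S by (auto simp: \<Lambda>_def generates_bounded_operator_def bounded_clinear_ell2_def
        intro: onorm_pos_le)
  \<comment> \<open>A ball of radius \<open>2 M \<delta>\<close> holds at most
    \<open>(4 M \<delta> / s + 1)^d\<close> points, and this is at most \<open>(E M)^d\<close> when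
    \<open>M >= 1\<close>.\<close>
  define E where "E = 4 * \<delta> / s + 1"
  have E: "0 < E" using \<delta> s by (simp add: E_def add_pos_pos)
  \<comment> \<open>What remains after \<open>M^d\<close> cancels between the lower count for radius
    \<open>M \<delta>\<close> and the upper count for radius \<open>2 M \<delta>\<close>.\<close>
  define K where "K = \<Lambda> * E ^ d / (\<kappa> * (\<kappa> * \<delta> ^ d / (2 * real d)))"
  \<comment> \<open>The threshold gives \<open>M + 1 >= 2 (m + 1)\<close>, so cutting off the
    initial part costs at most half: \<open>(M + 1)^d - (m + 1)^d >= M^d / 2\<close>.\<close>
  have J_le: "J M \<le> K" if M: "M \<ge> Suc (2 * m)" for M
  proof -
    have mM: "m \<le> M" "1 \<le> M" using M by auto
    have row: "\<kappa> * J M \<le> (\<Sum>k | norm (Y k - Y j) < real M * \<delta>. f (norm (Y k - Y j)))" for j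
      unfolding \<kappa>_def J_def by (rule regular_sum_ge[OF c \<delta> reg fin m mM(1)])
    have "\<kappa> * \<delta> ^ d / (2 * real d) * real M ^ d \<le> real (card (B (real M * \<delta>)))"
    proof -
      have "(2 * real (Suc m)) ^ d \<le> real (Suc M) ^ d"
        using M by (intro power_mono) auto
      moreover have "2 * real (Suc m) ^ d \<le> (2 * real (Suc m)) ^ d"
        using d(2) self_le_power[of 2 d] unfolding power_mult_distrib
        by (intro mult_right_mono) auto
      moreover have "real M ^ d \<le> real (Suc M) ^ d" by (intro power_mono) auto
      ultimately have "real M ^ d / 2 \<le> real (Suc M) ^ d - real (Suc m) ^ d" by linarith
      then have "\<delta> ^ d / real d * (real M ^ d / 2)
          \<le> \<delta> ^ d / real d * (real (Suc M) ^ d - real (Suc m) ^ d)"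
        using \<delta> by (intro mult_left_mono) auto
      also have "\<dots> = 1 * (((real (Suc M) * \<delta>) ^ d - (real (Suc m) * \<delta>) ^ d) / real d)"
        unfolding power_mult_distrib by (simp add: algebra_simps diff_divide_distrib)
      also have "\<dots> \<le> integral {real (Suc m) * \<delta>..real (Suc M) * \<delta>} (one.moment d)"
        using \<delta> mM d by (intro one.integral_moment_ge mult_right_mono) auto
      finally have "\<kappa> * (\<delta> ^ d / real d * (real M ^ d / 2))
          \<le> \<kappa> * integral {real (Suc m) * \<delta>..real (Suc M) * \<delta>} (one.moment d)"
        using \<kappa> by (intro mult_left_mono) auto
      also have "\<dots> \<le> (\<Sum>k | norm (Y k - Y 0) < real M * \<delta>. 1)"
        unfolding \<kappa>_def by (rule one.regular_sum_ge[OF c \<delta> reg fin m mM(1)])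
      finally show ?thesis by (simp add: B_def Y0 mult_ac)
    qed
    then have lower: "\<kappa> * \<delta> ^ d / (2 * real d) * real M ^ d * (\<kappa> * J M)
        \<le> real (card (B (real M * \<delta>))) * (\<kappa> * J M)"
      using \<kappa> J_nonneg[of M] by (intro mult_right_mono) auto
    have "real (card (B (real M * \<delta>))) * (\<kappa> * J M)
        = (\<Sum>j\<in>B (real M * \<delta>). \<kappa> * J M)" by simp
    \<comment> \<open>Doubling the radius places the ball of radius \<open>M \<delta>\<close> about
      each such \<open>Y j\<close> inside the test set, so the row estimate applies uncut; the rows
      added afterwards contribute nonnegative terms.\<close>
    also have "\<dots> \<le> (\<Sum>j\<in>B (real M * \<delta>). \<Sum>k\<in>B (2 * real M * \<delta>). f (norm (Y j - Y k)))"
    proof (rule sum_mono)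
      fix j assume j: "j \<in> B (real M * \<delta>)"
      have "{k. norm (Y k - Y j) < real M * \<delta>} \<subseteq> B (2 * real M * \<delta>)"
      proof
        fix k assume "k \<in> {k. norm (Y k - Y j) < real M * \<delta>}"
        then show "k \<in> B (2 * real M * \<delta>)"
          using j norm_triangle_ineq[of "Y k - Y j" "Y j"] by (auto simp: B_def)
      qed
      then have "(\<Sum>k | norm (Y k - Y j) < real M * \<delta>. f (norm (Y k - Y j)))
          \<le> (\<Sum>k\<in>B (2 * real M * \<delta>). f (norm (Y k - Y j)))"
        by (intro sum_mono2 B_fin f_nonneg) auto
      with row[of j] show "\<kappa> * J M \<le> (\<Sum>k\<in>B (2 * real M * \<delta>). f (norm (Y j - Y k)))"
        by (simp add: norm_minus_commute)
    qed
    also have "\<dots> \<le> (\<Sum>j\<in>B (2 * real M * \<delta>). \<Sum>k\<in>B (2 * real M * \<delta>). f (norm (Y j - Y k)))"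
    proof (rule sum_mono2[OF B_fin])
      have "real M * \<delta> \<le> 2 * real M * \<delta>" using \<delta> by simp
      then show "B (real M * \<delta>) \<subseteq> B (2 * real M * \<delta>)"
        unfolding B_def by (intro Collect_mono) linarith
    qed (intro sum_nonneg f_nonneg norm_ge_zero)
    also have "\<dots> = Re (\<Sum>j\<in>B (2 * real M * \<delta>). \<Sum>k\<in>B (2 * real M * \<delta>). schoenberg_matrix Y f j k)"
      by (simp add: schoenberg_matrix_def)
    also have "\<dots> \<le> \<Lambda> * real (card (B (2 * real M * \<delta>)))"
      unfolding \<Lambda>_def by (rule generates_bounded_operator_sum_le[OF S B_fin])
    also have "\<dots> \<le> \<Lambda> * (E * real M) ^ d"
    proof (rule mult_left_mono[OF _ \<Lambda>])
      have "real (card (B (2 * real M * \<delta>))) \<le> (2 * (2 * real M * \<delta>) / s + 1) ^ d"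
        using card_ball_le(2)[OF d s, of "2 * real M * \<delta>" 0] \<delta> by (simp add: B_def Y0)
      also have "2 * (2 * real M * \<delta>) / s + 1 = 4 * \<delta> / s * real M + 1" by simp
      also have "(4 * \<delta> / s * real M + 1) ^ d \<le> (4 * \<delta> / s * real M + real M) ^ d"
        using mM \<delta> s(1) by (intro power_mono add_mono add_nonneg_nonneg) auto
      also have "4 * \<delta> / s * real M + real M = E * real M"
        unfolding E_def by (simp only: distrib_right mult_1)
      finally show "real (card (B (2 * real M * \<delta>))) \<le> (E * real M) ^ d" .
    qed
    also have "\<dots> = \<Lambda> * E ^ d * real M ^ d" by (simp add: power_mult_distrib)
    finally have "(\<kappa> * (\<kappa> * \<delta> ^ d / (2 * real d)) * J M) * real M ^ d \<le> (\<Lambda> * E ^ d) * real M ^ d"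
      using lower by (simp only: mult_ac)
    then have "\<kappa> * (\<kappa> * \<delta> ^ d / (2 * real d)) * J M \<le> \<Lambda> * E ^ d"
      by (rule mult_right_le_imp_le) (use mM in auto)
    moreover have "0 < \<kappa> * (\<kappa> * \<delta> ^ d / (2 * real d))"
      using \<kappa> \<delta> d by simp
    ultimately show ?thesis
      unfolding K_def by (simp only: pos_le_divide_eq mult_ac)
  qed
  show ?thesis
  proof (rule set_integrable_moment_if_bounded[OF \<delta>])
    fix M assume M: "M \<ge> Suc (Suc (2 * m))"
    then obtain M' where M': "M = Suc M'" by (cases M) auto
    have "integral {0..real (Suc m) * \<delta>} (moment d) + J M' = integral {0..real M * \<delta>} (moment d)"
      unfolding J_def M' using M M' \<delta>
      by (intro Henstock_Kurzweil_Integration.integral_combine integrable_on_moment mult_right_mono) auto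
    moreover have "J M' \<le> K" using M M' by (intro J_le) auto
    ultimately show "integral {0..real M * \<delta>} (moment d) \<le> integral {0..real (Suc m) * \<delta>} (moment d) + K"
      by linarith
  qed
qed

text \<open>As \<open>f 0 = 1\<close>, the matrix is the identity plus its off-diagonal part
  \<open>b\<close>, whose row sums are at most \<open>q\<close>. Both matrices are symmetric, so row
  bounds serve as column bounds in Schur's test, and \<open>S\<close> is the identity plus an
  operator of norm at most \<open>q\<close>.\<close>

lemma schoenberg_operator:
  fixes X :: "nat \<Rightarrow> real ^ 'n"
  assumes f0: "f 0 = 1" and int: "set_integrable lborel {0..} (moment d)"
    and d: "d = dim (span (range X))" "0 < d" and X: "separated X"
    and q: "q = (real d)\<^sup>2 * (5 / separation X) ^ d * (LBINT t:{0..}. moment d t)"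
  obtains S where "generates_bounded_operator (schoenberg_matrix X f) S"
    "onorm S \<le> 1 + q" "q < 1 \<Longrightarrow> has_bounded_inverse S"
proof -
  define b where "b k j = (if k = j then 0 else schoenberg_matrix X f k j)" for k j
  have s: "0 < separation X" "\<And>i j. i \<noteq> j \<Longrightarrow> separation X \<le> norm (X i - X j)"
    using X separation_le_norm[of _ _ X] by (auto simp: separated_def)
  have sym: "schoenberg_matrix X f k j = schoenberg_matrix X f j k" for k j
    by (simp add: schoenberg_matrix_def norm_minus_commute)
  then have b_sym: "b k j = b j k" for k j by (simp add: b_def)
  have b_row: "(\<Sum>j\<in>J. cmod (b k j)) \<le> q" if "finite J" for k J
  proof -
    have "(\<Sum>j\<in>J. cmod (b k j)) = (\<Sum>j\<in>J - {k}. f (norm (X j - X k)))"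
      using that
      by (intro sum.mono_neutral_cong_right)
        (auto simp: b_def schoenberg_matrix_def norm_minus_commute f_nonneg)
    also have "\<dots> \<le> q"
      unfolding q using that by (intro row_sum_le int d s) auto
    finally show ?thesis .
  qed
  have a_eq: "schoenberg_matrix X f k j = (if k = j then 1 else 0) + b k j" for k j
    by (simp add: b_def schoenberg_matrix_def f0)
  have a_row: "(\<Sum>j\<in>J. cmod (schoenberg_matrix X f k j)) \<le> 1 + q" if "finite J" for k J
  proof -
    have "(\<Sum>j\<in>J. cmod (schoenberg_matrix X f k j)) \<le> (\<Sum>j\<in>J. (if k = j then 1 else 0) + cmod (b k j))"
      unfolding a_eq by (intro sum_mono order_trans[OF norm_triangle_ineq]) auto
    also have "\<dots> \<le> 1 + q"
      using b_row[OF that, of k] that by (simp add: sum.distrib)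
    finally show ?thesis .
  qed
  obtain S where S: "generates_bounded_operator (schoenberg_matrix X f) S"
    and S_le: "\<And>x. norm (S x) \<le> (1 + q) * norm x"
    and S_sums: "\<And>x j. (\<lambda>k. schoenberg_matrix X f k j * ell2_nth x k) sums ell2_nth (S x) j"
  proof (rule schur_test[of "schoenberg_matrix X f" "1 + q"])
    show "(\<Sum>k\<in>K. cmod (schoenberg_matrix X f k j)) \<le> 1 + q" if "finite K" for j K
      using a_row[OF that, of j] by (simp add: sym[of _ j])
  qed (use a_row in blast)+
  obtain T where T: "generates_bounded_operator b T"
    and T_le: "\<And>x. norm (T x) \<le> q * norm x"
    and T_sums: "\<And>x j. (\<lambda>k. b k j * ell2_nth x k) sums ell2_nth (T x) j"
  proof (rule schur_test[of b q])
    show "(\<Sum>k\<in>K. cmod (b k j)) \<le> q" if "finite K" for j K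
      using b_row[OF that, of j] by (simp add: b_sym[of _ j])
  qed (use b_row in blast)+
  have "S x = x + T x" for x
  proof (rule ell2_eqI)
    fix j
    have "(\<lambda>k. (if k = j then ell2_nth x k else 0) + b k j * ell2_nth x k)
        sums (ell2_nth x j + ell2_nth (T x) j)"
      by (rule sums_add[OF sums_single T_sums])
    then have "(\<lambda>k. schoenberg_matrix X f k j * ell2_nth x k) sums (ell2_nth x j + ell2_nth (T x) j)"
      by (rule sums_cong[THEN iffD1, rotated]) (simp add: a_eq algebra_simps)
    then show "ell2_nth (S x) j = ell2_nth (x + T x) j"
      using sums_unique2[OF S_sums] by (simp add: plus_ell2.rep_eq)
  qed
  then have S_eq: "S = (\<lambda>x. x + T x)" by auto
  have q0: "0 \<le> q" using b_row[of "{}"] by simp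
  show thesis
  proof (rule that[OF S])
    show "onorm S \<le> 1 + q"
      by (rule onorm_bound) (use q0 S_le in auto)
    show "has_bounded_inverse S" if "q < 1"
      unfolding S_eq using T T_le that
      by (intro has_bounded_inverse_identity_plus) (auto simp: generates_bounded_operator_def)
  qed
qed

end

text \<open>Two distinct points cannot both vanish. Positivity makes the natural subtraction
  \<open>d - 1\<close> genuine and the exponents \<open>2 / d\<close> and \<open>1 / d\<close>
  meaningful.\<close>

lemma dim_span_range_pos:
  fixes X :: "nat \<Rightarrow> real ^ 'n"
  assumes "inj X"
  shows "0 < dim (span (range X))"
proof (rule ccontr)
  assume "\<not> 0 < dim (span (range X))"
  then have "range X \<subseteq> {0}" by (simp add: dim_eq_0)
  then have "X 0 = 0" "X 1 = 0" by blast+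
  then show False using injD[OF assms, of 0 1] by simp
qed

theorem theorem1p4:
  fixes f :: "real \<Rightarrow> real" and X :: "nat \<Rightarrow> real ^ 'n" and d :: nat
  assumes f_nonneg: "\<And>t. t \<ge> 0 \<Longrightarrow> f t \<ge> 0"
    and f_decr: "\<And>s t. 0 \<le> s \<Longrightarrow> s \<le> t \<Longrightarrow> f t \<le> f s"
    and f_0: "f 0 = 1"
    and X_distinct: "inj X"
    and X_sep: "separated X"
    and X_0: "X 0 = 0"
    and d_def: "d = dim (span (range X))"
  shows
    "(set_integrable lborel {0..} (\<lambda>t. t ^ (d - 1) * f t) \<longrightarrow>
        (\<exists>S. generates_bounded_operator (schoenberg_matrix X f) S) \<and>
        (\<forall>S. generates_bounded_operator (schoenberg_matrix X f) S \<longrightarrow>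
           onorm S \<le> 1 + (real d)\<^sup>2 * (5 / separation X) ^ d
                          * (LBINT t:{0..}. t ^ (d - 1) * f t)))
   \<and> (set_integrable lborel {0..} (\<lambda>t. t ^ (d - 1) * f t) \<and>
        separation X > 5 * real d powr (2 / real d)
                         * (LBINT t:{0..}. t ^ (d - 1) * f t) powr (1 / real d) \<longrightarrow>
        (\<forall>S. generates_bounded_operator (schoenberg_matrix X f) S \<longrightarrow> has_bounded_inverse S))
   \<and> ((\<exists>\<delta> > 0. \<exists>Y :: nat \<Rightarrow> real ^ 'n.
          delta_regular \<delta> Y \<and> dim (span (range Y)) = d \<and>
          (\<exists>S. generates_bounded_operator (schoenberg_matrix Y f) S)) \<longrightarrow>
        set_integrable lborel {0..} (\<lambda>t. t ^ (d - 1) * f t))"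
proof -
  interpret decreasing_profile f
    by standard (fact f_nonneg, fact f_decr)
  have d: "0 < d" unfolding d_def by (rule dim_span_range_pos[OF X_distinct])
  have mom: "(\<lambda>t. t ^ (d - 1) * f t) = moment d"
    by (simp add: moment_def fun_eq_iff)
  define I where "I = (LBINT t:{0..}. moment d t)"
  define q where "q = (real d)\<^sup>2 * (5 / separation X) ^ d * I"
  have main: "(\<exists>S. generates_bounded_operator (schoenberg_matrix X f) S) \<and>
      (\<forall>S. generates_bounded_operator (schoenberg_matrix X f) S \<longrightarrow>
        onorm S \<le> 1 + q \<and> (q < 1 \<longrightarrow> has_bounded_inverse S))"
    if int: "set_integrable lborel {0..} (moment d)"
  proof -
    obtain S where "generates_bounded_operator (schoenberg_matrix X f) S"
      "onorm S \<le> 1 + q" "q < 1 \<Longrightarrow> has_bounded_inverse S"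
      using schoenberg_operator[OF f_0 int d_def d X_sep q_def[unfolded I_def]] by blast
    then show ?thesis
      using generates_bounded_operator_unique by blast
  qed
  \<comment> \<open>Taking \<open>d\<close>-th powers turns the separation hypothesis into
    \<open>q < 1\<close>.\<close>
  have q_less: "q < 1" if sep: "5 * real d powr (2 / real d) * I powr (1 / real d) < separation X"
  proof -
    have s: "0 < separation X" using X_sep by (simp add: separated_def)
    have I: "0 \<le> I" unfolding I_def set_lebesgue_integral_def
      by (intro integral_nonneg_AE AE_I2) (auto simp: indicator_def moment_nonneg)
    have "(I powr (1 / real d)) ^ d = I"
      using I d by (cases "I = 0") (simp_all add: powr_power zero_power)
    moreover have "(real d powr (2 / real d)) ^ d = (real d)\<^sup>2"
      using d by (simp add: powr_power)
    ultimately have "5 ^ d * (real d)\<^sup>2 * I = (5 * real d powr (2 / real d) * I powr (1 / real d)) ^ d"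
      by (simp add: power_mult_distrib)
    also have "\<dots> < separation X ^ d"
      using sep d by (intro power_strict_mono) auto
    finally show ?thesis
      using s by (simp add: q_def power_divide field_simps)
  qed
  have conv: "set_integrable lborel {0..} (moment d)"
    if "delta_regular \<delta> Y" "dim (span (range Y)) = d"
      "generates_bounded_operator (schoenberg_matrix Y f) S" for \<delta> S and Y :: "nat \<Rightarrow> real ^ 'n"
    using set_integrable_moment_if_bounded_operator[OF that(1) that(2)[symmetric] d that(3)] .
  show ?thesis
    unfolding mom
    using main q_less conv unfolding I_def[symmetric] q_def[symmetric] by blast
qed

end
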